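(* Suppose that $$\lim_{d\to\infty}\frac{d^{\lambda_1}}{\sum_{j=1}^n d^{\lambda_j}+\sum_{i=1}^m c(\mathcal J(i,d))\,d^{\gamma_i}}=0 .$$ For $\ell>0$ let $a(d,\ell)=\mathrm E\big[1\wedge\frac{\pi(d,\mathbf Y^{(d)})}{\pi(d,\mathbf X^{(d)})}\big]$, where $\mathbf X^{(d)}\sim\pi(d,\cdot)$ and $\mathbf Y^{(d)}\mid\mathbf X^{(d)}\sim N(\mathbf X^{(d)},\frac{\ell^2}{d^\alpha}I_d)$. Let $$E_R=\lim_{d\to\infty}\sum_{i=1}^m\frac{c(\mathcal J(i,d))}{d^\alpha}\frac{d^{\gamma_i}}{K_{n+i}}\,\mathrm E\!\left[\left(\frac{f'(X)}{f(X)}\right)^2\right]\ (X\sim f),\qquad \upsilon(\ell)=2\ell^2\,\Phi\!\left(-\frac{\ell\sqrt{E_R}}{2}\right).$$ Then $$\lim_{d\to\infty}a(d,\ell)=2\,\Phi\!\left(-\frac{\ell\sqrt{E_R}}2\right)=:a(\ell).$$ Furthermore, $\upsilon(\ell)$ is maximized over $\ell>0$ at a unique value $\hat\ell$, given by $\hat\ell=2.38/\sqrt{E_R}$ (the constant $2.38$ being to two decimal places), and $a(\hat\ell)=0.234$ to three decimal places.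
   Context: Density $f$: $f$ is a positive $C^2$ probability density on $\mathbb R$, $(\log f)'$ is Lipschitz continuous, and, for $X\sim f$, $\mathrm E[(f'(X)/f(X))^4]<\infty$ and $\mathrm E[(f''(X)/f(X))^2]<\infty$. Target: for each $d$, $\pi(d,\mathbf x^{(d)})=\prod_{j=1}^d\theta_j(d)f(\theta_j(d)x_j)$ on $\mathbb R^d$. Here $0\le n<\infty$ and $1\le m<\infty$ are fixed integers, $K_1,\dots,K_{n+m}\in(0,\infty)$ are constants, and $\lambda_1\ge\dots\ge\lambda_n$, $\gamma_1\ge\dots\ge\gamma_m$ are real numbers. For $j=1,\dots,n$, $\theta_j^{-2}(d)=K_j/d^{\lambda_j}$. The remaining indices $\{n+1,\dots,d\}$ are partitioned into $m$ disjoint sets $\mathcal J(1,d),\dots,\mathcal J(m,d)$, with $\theta_j^{-2}(d)=K_{n+i}/d^{\gamma_i}$ for all $j\in\mathcal J(i,d)$, arranged so that $n+i\in\mathcal J(i,d)$. The cardinality $c(\mathcal J(i,d))$ of $\mathcal J(i,d)$ is a polynomial function of $d$ with $c(\mathcal J(i,d))\to\infty$ as $d\to\infty$. If $n=0$, conditions involving $\lambda_1$ are regarded as vacuous (satisfied). Component of interest: $i^*\in\{1,\dots,n+m\}$ is fixed and $\theta_{i^*}(d)=1$ for all $d$. Exponent $\alpha$: the smallest number such that $\lim_{d\to\infty}d^{\lambda_1}/d^\alpha<\infty$ and $\lim_{d\to\infty}d^{\gamma_i}c(\mathcal J(i,d))/d^\alpha<\infty$ for all $i=1,\dots,m$. $\Phi$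 is the standard normal c.d.f. *)

theory Defs
  imports
    "HOL-Probability.Probability"
    "HOL-Computational_Algebra.Polynomial"
begin

text \<open>
  Limits \<open>d \<rightarrow> \<infinity>\<close> are taken along an infinite set \<open>D\<close> of admissible dimensions;
  \<open>D = {n + m..}\<close> is the case of all dimensions.  The set is needed because group sizes such as
  \<open>d / 2\<close> are polynomial in \<open>d\<close> only along suitable dimensions: polynomials
  \<open>c\<^sub>1, \<dots>, c\<^sub>m\<close> tending to infinity, taking natural values at all large \<open>d\<close> and having sum
  \<open>d - n\<close> exist only for \<open>m = 1\<close>.
\<close>

definition dims_at_top :: "nat set \<Rightarrow> nat filter" where
  "dims_at_top D = inf at_top (principal D)"

definition euclid :: "nat \<Rightarrow> (nat \<Rightarrow> real) measure" where
  "euclid d = PiM {1..d} (\<lambda>_. lborel)"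

definition target_density ::
    "(real \<Rightarrow> real) \<Rightarrow> (nat \<Rightarrow> nat \<Rightarrow> real) \<Rightarrow> nat \<Rightarrow> (nat \<Rightarrow> real) \<Rightarrow> real" where
  "target_density f \<theta> d x = (\<Prod>j=1..d. \<theta> j d * f (\<theta> j d * x j))"

text \<open>
  Joint law of \<open>(X, Y)\<close> where \<open>X\<close> has the target density and, given \<open>X = x\<close>,
  \<open>Y\<close> is Gaussian with mean \<open>x\<close> and covariance matrix \<open>(l\<^sup>2 / d\<^sup>\<alpha>) I\<close>; note that
  \<^const>\<open>normal_density\<close> takes the standard deviation.
\<close>

definition joint_law ::
    "(real \<Rightarrow> real) \<Rightarrow> (nat \<Rightarrow> nat \<Rightarrow> real) \<Rightarrow> real \<Rightarrow> nat \<Rightarrow> real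
      \<Rightarrow> ((nat \<Rightarrow> real) \<times> (nat \<Rightarrow> real)) measure" where
  "joint_law f \<theta> \<alpha> d l =
     density (euclid d \<Otimes>\<^sub>M euclid d)
       (\<lambda>(x, y). ennreal (target_density f \<theta> d x *
          (\<Prod>j=1..d. normal_density (x j) (sqrt (l\<^sup>2 / real d powr \<alpha>)) (y j))))"

definition expected_acceptance ::
    "(real \<Rightarrow> real) \<Rightarrow> (nat \<Rightarrow> nat \<Rightarrow> real) \<Rightarrow> real \<Rightarrow> nat \<Rightarrow> real \<Rightarrow> real" where
  "expected_acceptance f \<theta> \<alpha> d l =
     (\<integral>(x, y). min 1 (target_density f \<theta> d y / target_density f \<theta> d x) \<partial>joint_law f \<theta> \<alpha> d l)"

definition scaling_admissible ::
    "nat set \<Rightarrow> nat \<Rightarrow> nat \<Rightarrow> (nat \<Rightarrow> real) \<Rightarrow> (nat \<Rightarrow> real) \<Rightarrow> (nat \<Rightarrow> nat \<Rightarrow> nat set)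
      \<Rightarrow> real \<Rightarrow> bool" where
  "scaling_admissible D n m lam gam J \<alpha> \<longleftrightarrow>
     (1 \<le> n \<longrightarrow> (\<exists>L. ((\<lambda>d. real d powr lam 1 / real d powr \<alpha>) \<longlongrightarrow> L) (dims_at_top D))) \<and>
     (\<forall>i\<in>{1..m}. \<exists>L. ((\<lambda>d. real d powr gam i * real (card (J i d)) / real d powr \<alpha>) \<longlongrightarrow> L)
        (dims_at_top D))"

definition scaling_exponent ::
    "nat set \<Rightarrow> nat \<Rightarrow> nat \<Rightarrow> (nat \<Rightarrow> real) \<Rightarrow> (nat \<Rightarrow> real) \<Rightarrow> (nat \<Rightarrow> nat \<Rightarrow> nat set) \<Rightarrow> real" where
  "scaling_exponent D n m lam gam J = (LEAST \<alpha>. scaling_admissible D n m lam gam J \<alpha>)"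

abbreviation std_normal_cdf :: "real \<Rightarrow> real" where
  "std_normal_cdf \<equiv> cdf std_normal_distribution"

definition asymptotic_acceptance :: "real \<Rightarrow> real \<Rightarrow> real" where
  "asymptotic_acceptance E l = 2 * std_normal_cdf (- (l * sqrt E / 2))"

definition speed :: "real \<Rightarrow> real \<Rightarrow> real" where
  "speed E l = 2 * l\<^sup>2 * std_normal_cdf (- (l * sqrt E / 2))"

end

theory Submission
  imports Defs "HOL-Real_Asymp.Real_Asymp"
begin

text \<open>
  After rescaling, the log acceptance ratio is a sum of independent terms
  \<open>ln f(U + s Z) - ln f(U)\<close> with \<open>U\<close> distributed as \<open>f\<close>, \<open>Z\<close> standard normal and
  \<open>s = \<theta>\<^sub>j \<sigma>\<close>.  A second-order expansion, dominated thanks to the Lipschitz score, shows that the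
  characteristic function of one term is \<open>1 - s\<^sup>2 I (t\<^sup>2 + i t) / 2 + o(s\<^sup>2)\<close>, where
  \<open>I = E[(f'/f)\<^sup>2]\<close> also enters the mean because \<open>E[(ln f)''] = -I\<close>.  The choice of \<open>\<alpha>\<close> and the
  condition on \<open>\<lambda>\<^sub>1\<close> make all \<open>s\<close> uniformly small with \<open>\<Sum> s\<^sup>2 I \<rightarrow> v = l\<^sup>2 E\<^sub>R\<close>, so by Levy's
  theorem the log ratio converges to \<open>N(-v/2, v)\<close>, for which the expectation of
  \<open>1 \<and> exp\<close> is \<open>2 \<Phi>(-\<surd>v / 2)\<close>.  The optimum is the zero of
  \<open>2 \<Phi>(-u) - u \<phi>(u)\<close>, located by alternating Taylor bounds; there
  \<open>2 \<Phi>(-u) = u \<phi>(u)\<close>, which makes the optimal acceptance rate elementary to bound.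
\<close>

section \<open>The optimal speed\<close>

text \<open>One expansion serves every coordinate because \<theta>_j X_j has density f whatever
  \<theta>_j is: unequal groups only mean unequal s. What is needed is therefore a limit theorem for
  a triangular array whose entries are not identically distributed. An error of o(s^2) per factor,
  uniform over small s, is enough: characteristic functions lie in the closed unit disc, so the
  errors of the factors of a product merely add up. The remainder of ln f has to be quadratic for
  all increments, not just small ones, since Gaussian steps are unbounded; this is what the
  Lipschitz score provides. Polynomial group sizes give each group a pure power of d as growth rate,
  so that a least \<alpha> exists at all. The condition on \<lambda>_1 yields \<lambda>_1 <
  \<alpha>, which serves twice: the n single coordinates become negligible, and \<alpha> must be
  attained by a group. Together with positive Fisher information this gives E_R > 0, without which
  no finite maximiser would exist.\<close>

lemma cdf_density_has_real_derivative:
  fixes g :: "real \<Rightarrow> real"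
  assumes g: "continuous_on UNIV g" "\<And>x. 0 \<le> g x"
    and dist: "real_distribution (density lborel g)"
  shows "(cdf (density lborel g) has_real_derivative g u) (at u)"
proof -
  let ?M = "density lborel g"
  interpret M: real_distribution ?M by fact
  have [measurable]: "g \<in> borel_measurable borel"
    using g(1) by (rule borel_measurable_continuous_onI)
  \<comment> \<open>The fundamental theorem yields a derivative within a compact interval; a window
    with \<open>u\<close> in its interior upgrades it to a full derivative.\<close>
  define a b where "a = u - 1" and "b = u + 1"
  have cdf_eq: "cdf ?M a + (LBINT y=a..x. g y) = cdf ?M x" if "x \<in> {a..b}" for x
  proof (cases "a = x")
    case True
    then show ?thesis by simp
  next
    case False
    with that have ax: "a < x" by auto
    have "cdf ?M x - cdf ?M a = measure ?M {a<..x}"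
      using M.cdf_diff_eq[OF ax] .
    also have "\<dots> = (\<integral>y. indicator {a<..x} y \<partial>?M)"
      by simp
    also have "\<dots> = (LBINT y:{a<..x}. g y)"
      using g(2) by (subst integral_density) (auto simp: set_lebesgue_integral_def mult.commute)
    also have "\<dots> = (LBINT y=a..x. g y)"
      using ax by (simp add: interval_integral_Ioc)
    finally show ?thesis by simp
  qed
  have "((\<lambda>x. LBINT y=a..x. g y) has_vector_derivative g u) (at u within {a..b})"
    by (rule interval_integral_FTC2) (auto simp: a_def b_def intro: continuous_on_subset[OF g(1)])
  then have "((\<lambda>x. cdf ?M a + (LBINT y=a..x. g y)) has_real_derivative g u) (at u within {a..b})"
    unfolding has_real_derivative_iff_has_vector_derivative
    by (auto intro!: derivative_eq_intros)
  then have "(cdf ?M has_real_derivative g u) (at u within {a..b})"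
    by (rule has_field_derivative_transform_within[of _ _ _ _ 1]) (use cdf_eq in \<open>auto simp: a_def b_def\<close>)
  moreover have "u \<in> interior {a..b}" by (auto simp: a_def b_def)
  ultimately show ?thesis by (metis at_within_interior)
qed

lemma std_normal_cdf_deriv [derivative_intros]:
  assumes "(g has_real_derivative g') (at x)"
  shows "((\<lambda>x. std_normal_cdf (g x)) has_real_derivative std_normal_density (g x) * g') (at x)"
proof (rule DERIV_chain2[OF cdf_density_has_real_derivative assms])
  show "continuous_on UNIV std_normal_density"
    unfolding normal_density_def by (intro continuous_intros) auto
qed (auto intro: real_dist_normal_dist)

lemma std_normal_cdf_at_top: "(std_normal_cdf \<longlongrightarrow> 1) at_top"
  using real_distribution.cdf_lim_at_top_prob[OF real_dist_normal_dist] .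

lemma std_normal_cdf_at_bot: "(std_normal_cdf \<longlongrightarrow> 0) at_bot"
proof -
  interpret real_distribution std_normal_distribution by (rule real_dist_normal_dist)
  show ?thesis by (rule cdf_lim_at_bot)
qed

lemma std_normal_density_uminus: "std_normal_density (- x) = std_normal_density x"
  by (simp add: std_normal_density_def)

text \<open>The density is even, so the sum of both values has derivative zero; its constant value
  is read off at infinity.\<close>

lemma std_normal_cdf_uminus: "std_normal_cdf (- x) = 1 - std_normal_cdf x"
proof -
  let ?S = "\<lambda>x. std_normal_cdf (- x) + std_normal_cdf x"
  have "(?S has_real_derivative 0) (at x)" for x
    by (auto intro!: derivative_eq_intros simp: std_normal_density_uminus)
  then have const: "?S y = ?S x" for y
    by (intro DERIV_isconst_all) auto
  have "(?S \<longlongrightarrow> 0 + 1) at_top"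
    by (intro tendsto_add std_normal_cdf_at_top filterlim_compose[OF std_normal_cdf_at_bot]
        filterlim_uminus_at_bot_at_top)
  moreover have "?S = (\<lambda>_. ?S x)"
    by (intro ext const)
  ultimately have "((\<lambda>y::real. ?S x) \<longlongrightarrow> 1) at_top"
    by (simp only: add_0_left)
  then have "?S x = 1"
    by (simp add: tendsto_const_iff)
  then show ?thesis by simp
qed

lemma std_normal_cdf_0: "std_normal_cdf 0 = 1 / 2"
  using std_normal_cdf_uminus[of 0] unfolding minus_zero by linarith

section \<open>Alternating Taylor bounds for the normal distribution function\<close>

lemma exp_ge_even_Taylor:
  assumes "even N"
  shows "(\<Sum>k<N. (x::real) ^ k / fact k) \<le> exp x"
  using Maclaurin_exp_le[of x N] assms by (auto simp: zero_le_even_power)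

text \<open>The Lagrange remainder is a positive multiple of \<open>x ^ N\<close>, hence nonpositive
  here, while for even \<open>N\<close> it is nonnegative for every \<open>x\<close>.\<close>

lemma exp_le_odd_Taylor:
  assumes "odd N" "x \<le> 0"
  shows "exp x \<le> (\<Sum>k<N. (x::real) ^ k / fact k)"
proof -
  obtain t where t: "exp x = (\<Sum>m<N. (x ^ m) / fact m) + (exp t / fact N) * x ^ N"
    using Maclaurin_exp_le[of x N] by blast
  have "x ^ N \<le> 0" using assms by (simp add: power_le_zero_eq odd_pos)
  then have "(exp t / fact N) * x ^ N \<le> 0" by (intro mult_nonneg_nonpos) auto
  with t show ?thesis by simp
qed

lemma sqrt_two_pi_density: "sqrt (2 * pi) * std_normal_density x = exp (- x\<^sup>2 / 2)"
  by (simp add: std_normal_density_def)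

text \<open>The term-wise integral over \<open>[0, u]\<close> of the Taylor series of \<open>exp (- x\<^sup>2 / 2)\<close>.\<close>

definition gauss_poly :: "nat \<Rightarrow> real \<Rightarrow> real" where
  "gauss_poly N u = (\<Sum>k<N. (-1) ^ k * u ^ (2 * k + 1) / (2 ^ k * fact k * (2 * real k + 1)))"

lemma gauss_poly_deriv:
  "(gauss_poly N has_real_derivative (\<Sum>k<N. (- u\<^sup>2 / 2) ^ k / fact k)) (at u)"
proof -
  have "((\<lambda>u::real. (-1) ^ k * u ^ (2 * k + 1) / (2 ^ k * fact k * (2 * real k + 1)))
      has_real_derivative (- u\<^sup>2 / 2) ^ k / fact k) (at u)" for k
  proof -
    have "((\<lambda>u::real. (-1) ^ k * u ^ (2 * k + 1) / (2 ^ k * fact k * (2 * real k + 1)))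
      has_real_derivative (-1) ^ k * (real (2 * k + 1) * u ^ (2 * k)) / (2 ^ k * fact k * (2 * real k + 1))) (at u)"
      by (intro DERIV_cdivide DERIV_cmult) (use DERIV_pow[of "2 * k + 1" u] in simp)
    also have "(-1) ^ k * (real (2 * k + 1) * u ^ (2 * k)) / (2 ^ k * fact k * (2 * real k + 1))
        = (- u\<^sup>2 / 2) ^ k / fact k"
    proof -
      have "(- u\<^sup>2 / 2) ^ k = (-1) ^ k * u ^ (2 * k) / 2 ^ k"
        unfolding power_mult power_mult_distrib[symmetric] power_divide[symmetric] by simp
      moreover have "a * (c * b) / (p * q * c) = a * b / p / q" if "c \<noteq> 0" for a b c p q :: real
        using that by simp
      moreover have "real (2 * k + 1) = 2 * real k + 1" "2 * real k + 1 \<noteq> 0" by simp_all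
      ultimately show ?thesis by metis
    qed
    finally show ?thesis .
  qed
  then show ?thesis
    unfolding gauss_poly_def[abs_def] by (intro DERIV_sum) 
qed

lemma gauss_poly_0: "gauss_poly N 0 = 0"
  by (simp add: gauss_poly_def)

text \<open>The difference of the two sides vanishes at 0, and its derivative is the Taylor error of
  exp at -x^2/2, whose sign is fixed by the parity of \<open>N\<close>.\<close>

lemma std_normal_cdf_ge_gauss_poly:
  assumes "0 \<le> u" "even N"
  shows "gauss_poly N u \<le> sqrt (2 * pi) * (std_normal_cdf u - 1 / 2)"
proof -
  let ?h = "\<lambda>u. sqrt (2 * pi) * (std_normal_cdf u - 1 / 2) - gauss_poly N u"
  have "?h 0 \<le> ?h u"
  proof (rule DERIV_nonneg_imp_nondecreasing[OF assms(1)])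
    fix x :: real
    have "(?h has_real_derivative sqrt (2 * pi) * std_normal_density x
        - (\<Sum>k<N. (- x\<^sup>2 / 2) ^ k / fact k)) (at x)"
      by (auto intro!: derivative_eq_intros gauss_poly_deriv)
    then show "\<exists>y. (?h has_real_derivative y) (at x) \<and> 0 \<le> y"
      using exp_ge_even_Taylor[OF assms(2), of "- x\<^sup>2 / 2"]
      unfolding sqrt_two_pi_density by force
  qed
  then show ?thesis by (simp add: std_normal_cdf_0 gauss_poly_0)
qed

lemma std_normal_cdf_le_gauss_poly:
  assumes "0 \<le> u" "odd N"
  shows "sqrt (2 * pi) * (std_normal_cdf u - 1 / 2) \<le> gauss_poly N u"
proof -
  let ?h = "\<lambda>u. gauss_poly N u - sqrt (2 * pi) * (std_normal_cdf u - 1 / 2)"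
  have "?h 0 \<le> ?h u"
  proof (rule DERIV_nonneg_imp_nondecreasing[OF assms(1)])
    fix x :: real
    have "(?h has_real_derivative (\<Sum>k<N. (- x\<^sup>2 / 2) ^ k / fact k)
        - sqrt (2 * pi) * std_normal_density x) (at x)"
      by (auto intro!: derivative_eq_intros gauss_poly_deriv)
    then show "\<exists>y. (?h has_real_derivative y) (at x) \<and> 0 \<le> y"
      using exp_le_odd_Taylor[OF assms(2), of "- x\<^sup>2 / 2"]
      unfolding sqrt_two_pi_density by force
  qed
  then show ?thesis by (simp add: std_normal_cdf_0 gauss_poly_0)
qed

section \<open>Sign of the derivative of the speed\<close>

definition speed_slope :: "real \<Rightarrow> real" where
  "speed_slope u = 2 * std_normal_cdf (- u) - u * std_normal_density u"

lemma std_normal_density_deriv: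
  "(std_normal_density has_real_derivative - u * std_normal_density u) (at u)"
proof -
  have "((\<lambda>u. 1 / sqrt (2 * pi) * exp (- u\<^sup>2 / 2)) has_real_derivative
      1 / sqrt (2 * pi) * (exp (- u\<^sup>2 / 2) * - u)) (at u)"
    by (intro DERIV_cmult) (auto intro!: derivative_eq_intros)
  then show ?thesis
    by (simp add: std_normal_density_def[abs_def] mult_ac)
qed

text \<open>The derivative changes sign only at sqrt 3 on the positive axis: the slope falls
  strictly up to there and then climbs back towards 0.\<close>

lemma speed_slope_deriv:
  "(speed_slope has_real_derivative (u\<^sup>2 - 3) * std_normal_density u) (at u)"
  unfolding speed_slope_def[abs_def]
  by (auto intro!: derivative_eq_intros std_normal_density_deriv
      simp: std_normal_density_uminus algebra_simps power2_eq_square)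

lemma sqrt_two_pi_bounds: "2.5066 < sqrt (2 * pi)" "sqrt (2 * pi) < 2.5067"
proof -
  have "(2.5066::real)\<^sup>2 < 2 * pi" "2 * pi < (2.5067::real)\<^sup>2"
    using pi_approx by (auto simp: power2_eq_square)
  then show "2.5066 < sqrt (2 * pi)" "sqrt (2 * pi) < 2.5067"
    by (metis real_less_rsqrt) (rule real_less_lsqrt; use \<open>2 * pi < 2.5067\<^sup>2\<close> in simp)
qed

lemma sqrt_two_pi_speed_slope:
  "sqrt (2 * pi) * speed_slope u =
     sqrt (2 * pi) - 2 * (sqrt (2 * pi) * (std_normal_cdf u - 1 / 2)) - u * exp (- u\<^sup>2 / 2)"
  using sqrt_two_pi_density[of u] unfolding speed_slope_def std_normal_cdf_uminus
  by (simp add: algebra_simps)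

text \<open>The points \<open>19 / 16\<close> and \<open>477 / 400\<close> are \<open>(2.38 - 0.005) / 2\<close> and \<open>(2.38 + 0.005) / 2\<close>.\<close>

lemma speed_slope_lower_point: "speed_slope (19 / 16) > 0"
proof -
  \<comment> \<open>The distribution function and the exponential both enter
    \<open>sqrt_two_pi_speed_slope\<close> negatively, so a lower bound needs upper bounds on both:
    an odd number of terms.\<close>
  have "sqrt (2 * pi) * (std_normal_cdf (19 / 16) - 1 / 2) \<le> gauss_poly 7 (19 / 16)"
    by (rule std_normal_cdf_le_gauss_poly) auto
  moreover have "exp (- (19 / 16)\<^sup>2 / 2) \<le> (\<Sum>k<7. (- (19 / 16)\<^sup>2 / 2 :: real) ^ k / fact k)"
    by (rule exp_le_odd_Taylor) auto
  ultimately have "sqrt (2 * pi) * speed_slope (19 / 16) > 0"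
    using sqrt_two_pi_bounds unfolding sqrt_two_pi_speed_slope
    by (simp add: gauss_poly_def lessThan_nat_numeral fact_numeral power_divide field_simps)
  then show ?thesis by (simp add: zero_less_mult_iff)
qed

lemma speed_slope_upper_point: "speed_slope (477 / 400) < 0"
proof -
  \<comment> \<open>Now lower bounds are needed on both, hence an even number of terms.\<close>
  have "sqrt (2 * pi) * (std_normal_cdf (477 / 400) - 1 / 2) \<ge> gauss_poly 8 (477 / 400)"
    by (rule std_normal_cdf_ge_gauss_poly) auto
  moreover have "exp (- (477 / 400)\<^sup>2 / 2) \<ge> (\<Sum>k<8. (- (477 / 400)\<^sup>2 / 2 :: real) ^ k / fact k)"
    by (rule exp_ge_even_Taylor) auto
  ultimately have "sqrt (2 * pi) * speed_slope (477 / 400) < 0"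
    using sqrt_two_pi_bounds unfolding sqrt_two_pi_speed_slope
    by (simp add: gauss_poly_def lessThan_nat_numeral fact_numeral power_divide field_simps)
  then show ?thesis by (simp add: mult_less_0_iff)
qed


lemma speed_slope_at_top: "(speed_slope \<longlongrightarrow> 0) at_top"
proof -
  have "((\<lambda>u::real. u * (1 / sqrt (2 * pi) * exp (- u\<^sup>2 / 2))) \<longlongrightarrow> 0) at_top"
    by real_asymp
  then have "((\<lambda>u. u * std_normal_density u) \<longlongrightarrow> 0) at_top"
    by (simp only: std_normal_density_def)
  moreover have "((\<lambda>u. std_normal_cdf (- u)) \<longlongrightarrow> 0) at_top"
    by (rule filterlim_compose[OF std_normal_cdf_at_bot filterlim_uminus_at_bot_at_top])
  ultimately have "((\<lambda>u. 2 * std_normal_cdf (- u) - u * std_normal_density u) \<longlongrightarrow> 2 * 0 - 0) at_top"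
    by (intro tendsto_intros)
  then show ?thesis by (simp add: speed_slope_def[abs_def])
qed

lemma std_normal_density_pos: "0 < std_normal_density u"
  by (simp add: std_normal_density_def)

lemma speed_slope_decreasing:
  assumes "0 \<le> a" "a < b" "b \<le> sqrt 3"
  shows "speed_slope b < speed_slope a"
proof (rule DERIV_neg_imp_decreasing_open[OF assms(2)])
  show "continuous_on {a..b} speed_slope"
    using speed_slope_deriv by (intro DERIV_continuous_on) (auto intro: has_field_derivative_at_within)
  fix x assume x: "a < x" "x < b"
  then have "x\<^sup>2 < (sqrt 3)\<^sup>2" using assms by (intro power_strict_mono) auto
  then show "\<exists>y. (speed_slope has_real_derivative y) (at x) \<and> y < 0"
    using speed_slope_deriv[of x] std_normal_density_pos[of x]
    by (auto intro!: exI simp: mult_less_0_iff)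
qed

lemma speed_slope_increasing:
  assumes "sqrt 3 \<le> a" "a < b"
  shows "speed_slope a < speed_slope b"
proof (rule DERIV_pos_imp_increasing_open[OF assms(2)])
  show "continuous_on {a..b} speed_slope"
    using speed_slope_deriv by (intro DERIV_continuous_on) (auto intro: has_field_derivative_at_within)
  fix x assume x: "a < x" "x < b"
  then have "(sqrt 3)\<^sup>2 < x\<^sup>2" using assms by (intro power_strict_mono) auto
  then show "\<exists>y. (speed_slope has_real_derivative y) (at x) \<and> 0 < y"
    using speed_slope_deriv[of x] std_normal_density_pos[of x]
    by (auto intro!: exI)
qed

lemma speed_slope_neg:
  assumes "sqrt 3 \<le> u"
  shows "speed_slope u < 0"
proof -
  \<comment> \<open>The limit 0 gives only a non-strict bound; strictness is gained between
    \<open>u\<close> and \<open>u + 1\<close>.\<close>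
  have "speed_slope u < speed_slope (u + 1)"
    using assms by (intro speed_slope_increasing) auto
  also have "speed_slope (u + 1) \<le> 0"
  proof (rule tendsto_lowerbound[OF speed_slope_at_top])
    show "\<forall>\<^sub>F x in at_top. speed_slope (u + 1) \<le> speed_slope x"
      using eventually_ge_at_top[of "u + 1"]
    proof eventually_elim
      case (elim x)
      then show ?case
        using speed_slope_increasing[of "u + 1" x] assms by (cases "x = u + 1") auto
    qed
  qed simp
  finally show ?thesis .
qed

lemma sqrt_3_gt: "477 / 400 < sqrt 3"
  by (rule real_less_rsqrt) (simp add: power2_eq_square)

text \<open>The sign change is unique because sqrt 3 lies to the right of the bracket: the slope
  decreases strictly up to sqrt 3 and is negative from there on.\<close>

lemma speed_slope_root:
  obtains u where "19 / 16 < u" "u < 477 / 400" "speed_slope u = 0"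
    "\<And>x. 0 \<le> x \<Longrightarrow> x < u \<Longrightarrow> 0 < speed_slope x" "\<And>x. u < x \<Longrightarrow> speed_slope x < 0"
proof -
  have "continuous_on {19 / 16..477 / 400} speed_slope"
    using speed_slope_deriv by (intro DERIV_continuous_on) (auto intro: has_field_derivative_at_within)
  then obtain u where u: "19 / 16 \<le> u" "u \<le> 477 / 400" "speed_slope u = 0"
    using IVT2'[of speed_slope "477 / 400" 0 "19 / 16"] speed_slope_lower_point speed_slope_upper_point
    by (auto simp: less_imp_le)
  moreover have "u \<noteq> 19 / 16" "u \<noteq> 477 / 400"
    using u(3) speed_slope_lower_point speed_slope_upper_point by (metis less_irrefl)+
  moreover have "0 < speed_slope x" if "0 \<le> x" "x < u" for x
    using speed_slope_decreasing[of x u] that u sqrt_3_gt by auto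
  moreover have "speed_slope x < 0" if "u < x" for x
    using speed_slope_decreasing[of u x] speed_slope_neg[of x] that u by (cases "x \<le> sqrt 3") auto
  ultimately show ?thesis by (intro that[of u]) auto
qed

section \<open>The maximiser and its acceptance rate\<close>

definition unit_speed :: "real \<Rightarrow> real" where
  "unit_speed u = u\<^sup>2 * std_normal_cdf (- u)"

text \<open>For positive u the derivative has the sign of \<open>speed_slope\<close>, which was
  defined by splitting off this factor u.\<close>

lemma unit_speed_deriv:
  "(unit_speed has_real_derivative u * speed_slope u) (at u)"
  unfolding unit_speed_def[abs_def] speed_slope_def
  by (auto intro!: derivative_eq_intros simp: std_normal_density_uminus algebra_simps power2_eq_square)

lemma unit_speed_maximizer:
  assumes u: "0 < u"
    and pos: "\<And>x. 0 \<le> x \<Longrightarrow> x < u \<Longrightarrow> 0 < speed_slope x"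
    and neg: "\<And>x. u < x \<Longrightarrow> speed_slope x < 0"
    and x: "0 < x" "x \<noteq> u"
  shows "unit_speed x < unit_speed u"
proof (cases "x < u")
  case True
  show ?thesis
  proof (rule DERIV_pos_imp_increasing_open[OF True])
    show "continuous_on {x..u} unit_speed"
      using unit_speed_deriv by (intro DERIV_continuous_on) (auto intro: has_field_derivative_at_within)
  next
    fix y assume "x < y" "y < u"
    then show "\<exists>D. (unit_speed has_real_derivative D) (at y) \<and> 0 < D"
      using unit_speed_deriv[of y] pos[of y] x
      by (auto intro!: exI)
  qed
next
  case False
  with x have less: "u < x" by simp
  show ?thesis
  proof (rule DERIV_neg_imp_decreasing_open[OF less])
    show "continuous_on {u..x} unit_speed"
      using unit_speed_deriv by (intro DERIV_continuous_on) (auto intro: has_field_derivative_at_within)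
  next
    fix y assume "u < y" "y < x"
    then show "\<exists>D. (unit_speed has_real_derivative D) (at y) \<and> D < 0"
      using unit_speed_deriv[of y] neg[of y] u
      by (auto intro!: exI simp: mult_less_0_iff)
  qed
qed

text \<open>The function x \<phi>(x) has derivative (1 - x^2) \<phi>(x) and so decreases beyond 1;
  its values at the two ends of the bracket are enough, and only the exponential has to be
  estimated.\<close>

lemma root_density_bounds:
  assumes "19 / 16 < u" "u < 477 / 400"
  shows "\<bar>u * std_normal_density u - 0.234\<bar> < 0.0005"
proof -
  have mono: "y * std_normal_density y < x * std_normal_density x" if "1 \<le> x" "x < y" for x y
  proof (rule DERIV_neg_imp_decreasing_open[OF \<open>x < y\<close>])
    have deriv: "((\<lambda>u. u * std_normal_density u) has_real_derivative
        (1 - z\<^sup>2) * std_normal_density z) (at z)" for z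
      by (auto intro!: derivative_eq_intros std_normal_density_deriv simp: algebra_simps power2_eq_square)
    then show "continuous_on {x..y} (\<lambda>u. u * std_normal_density u)"
      by (intro DERIV_continuous_on) (auto intro: has_field_derivative_at_within)
    fix z assume z: "x < z" "z < y"
    then have "1 < z\<^sup>2" using that by (intro one_less_power) auto
    then show "\<exists>D. ((\<lambda>u. u * std_normal_density u) has_real_derivative D) (at z) \<and> D < 0"
      using deriv[of z] std_normal_density_pos[of z]
      by (auto intro!: exI simp: mult_less_0_iff)
  qed
  have scaled: "x * std_normal_density x = x * exp (- x\<^sup>2 / 2) / sqrt (2 * pi)" for x
    by (simp add: std_normal_density_def)
  have "exp (- (19 / 16)\<^sup>2 / 2) \<le> (\<Sum>k<7. (- (19 / 16)\<^sup>2 / 2 :: real) ^ k / fact k)"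
    by (rule exp_le_odd_Taylor) auto
  then have "19 / 16 * exp (- (19 / 16)\<^sup>2 / 2) < 0.2345 * (2.5066::real)"
    by (simp add: lessThan_nat_numeral fact_numeral power_divide field_simps)
  also have "\<dots> \<le> 0.2345 * sqrt (2 * pi)"
    using sqrt_two_pi_bounds by simp
  finally have "19 / 16 * std_normal_density (19 / 16) < 0.2345"
    unfolding scaled by (simp add: pos_divide_less_eq)
  moreover have "0.2335 < 477 / 400 * std_normal_density (477 / 400)"
  proof -
    have "exp (- (477 / 400)\<^sup>2 / 2) \<ge> (\<Sum>k<8. (- (477 / 400)\<^sup>2 / 2 :: real) ^ k / fact k)"
      by (rule exp_ge_even_Taylor) auto
    then have "0.2335 * (2.5067::real) < 477 / 400 * exp (- (477 / 400)\<^sup>2 / 2)"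
      by (simp add: lessThan_nat_numeral fact_numeral power_divide field_simps)
    moreover have "0.2335 * sqrt (2 * pi) < 0.2335 * 2.5067"
      using sqrt_two_pi_bounds(2) by (rule mult_strict_left_mono) simp
    ultimately have "0.2335 * sqrt (2 * pi) < 477 / 400 * exp (- (477 / 400)\<^sup>2 / 2)"
      by (rule less_trans[rotated])
    then show ?thesis
      unfolding scaled by (simp add: pos_less_divide_eq)
  qed
  moreover have "u * std_normal_density u < 19 / 16 * std_normal_density (19 / 16)"
    "477 / 400 * std_normal_density (477 / 400) < u * std_normal_density u"
    using mono[of "19 / 16" u] mono[of u "477 / 400"] assms by simp_all
  ultimately have "u * std_normal_density u < 0.2345" "0.2335 < u * std_normal_density u"
    by linarith+
  then show ?thesis
    unfolding abs_less_iff by simp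
qed

text \<open>The substitution u = l sqrt E / 2 removes E from the optimisation, so the optimal u is a
  universal number and 2 u is the constant 2.38.\<close>

lemma speed_unit_speed:
  assumes "0 < E"
  shows "speed E l = 8 / E * unit_speed (l * sqrt E / 2)"
  using assms by (simp add: speed_def unit_speed_def power_divide power_mult_distrib)

lemma speed_optimum:
  assumes E: "0 < E"
  shows "\<exists>lhat c. (\<forall>l. is_arg_max (speed E) (\<lambda>l. 0 < l) l \<longleftrightarrow> l = lhat) \<and>
       lhat = c / sqrt E \<and> \<bar>c - 2.38\<bar> < 0.005 \<and>
       \<bar>asymptotic_acceptance E lhat - 0.234\<bar> < 0.0005"
proof -
  obtain u where u: "19 / 16 < u" "u < 477 / 400" "speed_slope u = 0"
    "\<And>x. 0 \<le> x \<Longrightarrow> x < u \<Longrightarrow> 0 < speed_slope x" "\<And>x. u < x \<Longrightarrow> speed_slope x < 0"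
    using speed_slope_root by blast
  define lhat where "lhat = 2 * u / sqrt E"
  have lhat: "0 < lhat" "lhat * sqrt E / 2 = u"
    using u E by (auto simp: lhat_def)
  have less: "speed E l < speed E lhat" if "0 < l" "l \<noteq> lhat" for l
  proof -
    have "l * sqrt E / 2 \<noteq> u"
      using that E by (auto simp: lhat_def field_simps)
    then have "unit_speed (l * sqrt E / 2) < unit_speed u"
      using that E u by (intro unit_speed_maximizer[of u]) auto
    then show ?thesis
      unfolding speed_unit_speed[OF E] lhat(2) using E by (simp add: divide_strict_right_mono)
  qed
  have "is_arg_max (speed E) (\<lambda>l. 0 < l) l \<longleftrightarrow> l = lhat" for l
  proof
    assume "is_arg_max (speed E) (\<lambda>l. 0 < l) l"
    then show "l = lhat"
      using less[of l] lhat(1) by (auto simp: is_arg_max_def)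
  next
    assume "l = lhat"
    then show "is_arg_max (speed E) (\<lambda>l. 0 < l) l"
      using less lhat(1) by (auto simp: is_arg_max_def) (metis less_asym)
  qed
  moreover have "asymptotic_acceptance E lhat = u * std_normal_density u"
    using u(3) by (simp add: asymptotic_acceptance_def lhat(2) speed_slope_def)
  moreover have "\<bar>2 * u - 2.38\<bar> < 0.005"
    unfolding abs_less_iff using u(1,2) by simp
  ultimately show ?thesis
    using root_density_bounds[OF u(1,2)] by (intro exI[of _ lhat] exI[of _ "2 * u"]) (auto simp: lhat_def)
qed

section \<open>Expansion of the characteristic function of one coordinate\<close>

lemma (in pair_sigma_finite) product_function_integral:
  fixes a :: "_ \<Rightarrow> real" and b :: "_ \<Rightarrow> real"
  assumes a: "integrable M1 a" and b: "integrable M2 b"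
  shows "integrable (M1 \<Otimes>\<^sub>M M2) (\<lambda>w. a (fst w) * b (snd w))"
    and "(\<integral>w. a (fst w) * b (snd w) \<partial>(M1 \<Otimes>\<^sub>M M2)) = integral\<^sup>L M1 a * integral\<^sup>L M2 b"
proof -
  have [measurable]: "a \<in> borel_measurable M1" "b \<in> borel_measurable M2"
    using a b by auto
  show int: "integrable (M1 \<Otimes>\<^sub>M M2) (\<lambda>w. a (fst w) * b (snd w))"
    by (rule Fubini_integrable) (use a b in \<open>auto simp: abs_mult\<close>)
  show "(\<integral>w. a (fst w) * b (snd w) \<partial>(M1 \<Otimes>\<^sub>M M2)) = integral\<^sup>L M1 a * integral\<^sup>L M2 b"
    using integral_fst'[OF int] by simp
qed

text \<open>The increment \<open>h (x + 1) - h x\<close> integrates to zero by translation invariance, and to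
  the integral of \<open>h'\<close> by Fubini; this avoids discussing limits of \<open>h\<close> at infinity.\<close>

lemma integral_deriv_eq_0:
  fixes h h' :: "real \<Rightarrow> real"
  assumes deriv: "\<And>x. (h has_real_derivative h' x) (at x)" and cont: "continuous_on UNIV h'"
    and h: "integrable lborel h" and h': "integrable lborel h'"
  shows "integral\<^sup>L lborel h' = 0"
proof -
  have [measurable]: "h' \<in> borel_measurable borel"
    using cont by (rule borel_measurable_continuous_onI)
  let ?p = "\<lambda>(y, x). indicator {0..1::real} y * h' (y + x)"
  have shift: "integrable lborel (\<lambda>x. h' (y + x))" "(\<integral>x. h' (y + x) \<partial>lborel) = integral\<^sup>L lborel h'"
    "(\<integral>x. \<bar>h' (y + x)\<bar> \<partial>lborel) = (\<integral>x. \<bar>h' x\<bar> \<partial>lborel)" for y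
    using lborel_integrable_real_affine[OF h', of 1 y] lborel_integral_real_affine[of 1 h' y]
      lborel_integral_real_affine[of 1 "\<lambda>x. \<bar>h' x\<bar>" y] by auto
  have int: "integrable (lborel \<Otimes>\<^sub>M lborel) ?p"
  proof (rule lborel_pair.Fubini_integrable)
    show "integrable lborel (\<lambda>y. \<integral>x. norm (?p (y, x)) \<partial>lborel)"
      by (simp add: abs_mult shift)
  qed (auto simp: shift)
  have "integral\<^sup>L (lborel \<Otimes>\<^sub>M lborel) ?p = integral\<^sup>L lborel h'"
    using lborel_pair.integral_fst'[OF int] by (simp add: shift)
  moreover have "integral\<^sup>L (lborel \<Otimes>\<^sub>M lborel) ?p
      = (\<integral>x. (\<integral>y. indicator {0..1} y * h' (y + x) \<partial>lborel) \<partial>lborel)"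
    using lborel_pair.integral_snd[of "\<lambda>y x. indicator {0..1::real} y * h' (y + x)"] int by simp
  moreover have "(\<integral>y. indicator {0..1} y * h' (y + x) \<partial>lborel) = h (1 + x) - h x" for x
  proof -
    have "(\<integral>y. indicator {0..1} y *\<^sub>R h' (y + x) \<partial>lborel) = h (1 + x) - h (0 + x)"
    proof (rule integral_FTC_atLeastAtMost)
      fix y :: real
      have "((\<lambda>y. h (y + x)) has_real_derivative h' (y + x)) (at y within {0..1})"
        using DERIV_shift[of h "h' (y + x)" y x] deriv by (auto intro: has_field_derivative_at_within)
      then show "((\<lambda>y. h (y + x)) has_vector_derivative h' (y + x)) (at y within {0..1})"
        by (simp add: has_real_derivative_iff_has_vector_derivative)
    next
      show "continuous_on {0..1} (\<lambda>y. h' (y + x))"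
        by (intro continuous_intros continuous_on_compose2[OF cont]) auto
    qed auto
    then show ?thesis by simp
  qed
  moreover have "(\<integral>x. h (1 + x) - h x \<partial>lborel) = 0"
    using lborel_integrable_real_affine[OF h, of 1 1] lborel_integral_real_affine[of 1 h 1] h
    by (simp add: Bochner_Integration.integral_diff)
  ultimately show ?thesis by simp
qed


section \<open>Densities with Lipschitz score: moments and Fisher information\<close>

locale smooth_density =
  fixes f f' f'' :: "real \<Rightarrow> real" and C :: real
  assumes f_pos: "\<And>x. 0 < f x"
    and f_prob: "prob_space (density lborel (\<lambda>x. ennreal (f x)))"
    and f_deriv: "\<And>x. (f has_real_derivative f' x) (at x)"
    and f'_deriv: "\<And>x. (f' has_real_derivative f'' x) (at x)"
    and f''_cont: "continuous_on UNIV f''"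
    and score_lipschitz: "C-lipschitz_on UNIV (\<lambda>x. f' x / f x)"
    and score_sq_integrable: "integrable (density lborel (\<lambda>x. ennreal (f x))) (\<lambda>x. (f' x / f x)\<^sup>2)"
    and curvature_sq_integrable: "integrable (density lborel (\<lambda>x. ennreal (f x))) (\<lambda>x. (f'' x / f x)\<^sup>2)"
begin

definition F :: "real measure" where
  "F = density lborel (\<lambda>x. ennreal (f x))"

definition score :: "real \<Rightarrow> real" where
  "score x = f' x / f x"

text \<open>The derivative of \<open>score\<close>, in a form whose integrability splits into that
  of f''/f and of the squared score.\<close>

definition score' :: "real \<Rightarrow> real" where
  "score' x = f'' x / f x - (score x)\<^sup>2"

definition fisher :: real where
  "fisher = (\<integral>x. (score x)\<^sup>2 \<partial>F)"

lemma fisher_eq: "fisher = (\<integral>x. (f' x / f x)\<^sup>2 \<partial>density lborel (\<lambda>x. ennreal (f x)))"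
  by (simp add: fisher_def F_def score_def)

definition incr :: "real \<Rightarrow> real \<Rightarrow> real" where
  "incr u h = ln (f (u + h)) - ln (f u)"

text \<open>The characteristic function of one summand of the log acceptance ratio:
  \<open>fst w\<close> is the rescaled coordinate and \<open>s * snd w\<close> its rescaled proposed
  displacement.\<close>

definition step_char :: "real \<Rightarrow> real \<Rightarrow> complex" where
  "step_char t s = (\<integral>w. iexp (t * incr (fst w) (s * snd w)) \<partial>(F \<Otimes>\<^sub>M std_normal_distribution))"

lemma f_nonzero [simp]: "f x \<noteq> 0"
  using f_pos[of x] by simp

lemma f_nonneg [simp]: "0 \<le> f x"
  using f_pos[of x] by simp

lemma f_cont: "continuous_on UNIV f"
  using f_deriv by (intro DERIV_continuous_on) (auto intro: has_field_derivative_at_within)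

lemma f'_cont: "continuous_on UNIV f'"
  using f'_deriv by (intro DERIV_continuous_on) (auto intro: has_field_derivative_at_within)

lemma measurable_f [measurable]:
  "f \<in> borel_measurable borel" "f' \<in> borel_measurable borel" "f'' \<in> borel_measurable borel"
  using f_cont f'_cont f''_cont by (auto intro: borel_measurable_continuous_onI)

lemma measurable_score [measurable]:
  "score \<in> borel_measurable borel" "score' \<in> borel_measurable borel"
  unfolding score_def[abs_def] score'_def[abs_def] by measurable

lemma sets_F [measurable_cong, simp]: "sets F = sets borel"
  by (simp add: F_def)

lemma space_F [simp]: "space F = UNIV"
  by (simp add: F_def)

sublocale F: prob_space F
  unfolding F_def by (rule f_prob)

sublocale N: prob_space std_normal_distribution
  using real_dist_normal_dist by (simp add: real_distribution_def)

sublocale FN: pair_prob_space F std_normal_distribution ..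

lemma integrable_F_iff: "h \<in> borel_measurable borel \<Longrightarrow>
    integrable F h \<longleftrightarrow> integrable lborel (\<lambda>x. f x * h x)"
  unfolding F_def by (subst integrable_density) auto

lemma integral_F: "h \<in> borel_measurable borel \<Longrightarrow>
    integral\<^sup>L F h = (\<integral>x. f x * h x \<partial>lborel)"
  unfolding F_def by (subst integral_density) auto

lemma integrable_score_sq: "integrable F (\<lambda>x. (score x)\<^sup>2)"
  using score_sq_integrable by (simp add: F_def score_def)

lemma integrable_score: "integrable F score"
  by (rule F.square_integrable_imp_integrable[OF _ integrable_score_sq]) measurable

lemma integrable_curvature: "integrable F (\<lambda>x. f'' x / f x)"
proof (rule F.square_integrable_imp_integrable)
  show "integrable F (\<lambda>x. (f'' x / f x)\<^sup>2)"
    unfolding F_def by (rule curvature_sq_integrable)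
qed measurable

lemma integrable_score': "integrable F score'"
  unfolding score'_def[abs_def]
  by (intro Bochner_Integration.integrable_diff integrable_curvature integrable_score_sq)

text \<open>Under \<open>F\<close> the quotient f''/f integrates to the Lebesgue integral of f'',
  which is zero because f' and f'' are both integrable.\<close>

lemma integral_score': "integral\<^sup>L F score' = - fisher"
proof -
  have "integrable lborel f'" "integrable lborel f''"
    using integrable_score integrable_curvature by (auto simp: integrable_F_iff score_def)
  then have "integral\<^sup>L F (\<lambda>x. f'' x / f x) = 0"
    using integral_deriv_eq_0[OF f'_deriv f''_cont] by (simp add: integral_F)
  then show ?thesis
    unfolding score'_def[abs_def] fisher_def
    by (subst Bochner_Integration.integral_diff) (auto intro: integrable_curvature integrable_score_sq)
qed

text \<open>Zero Fisher information would make f constant, and a positive constant has infinite mass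
  on the line.\<close>

lemma fisher_pos: "0 < fisher"
proof (rule ccontr)
  assume "\<not> 0 < fisher"
  moreover have "0 \<le> fisher"
    unfolding fisher_def by (rule integral_nonneg_AE) auto
  ultimately have "fisher = 0"
    by linarith
  then have "(\<integral>x. (score x)\<^sup>2 \<partial>F) = 0"
    by (simp only: fisher_def)
  then have "AE x in F. (score x)\<^sup>2 = 0"
    by (subst (asm) integral_nonneg_eq_0_iff_AE[OF integrable_score_sq]) auto
  \<comment> \<open>Since f is positive, \<open>F\<close> and Lebesgue measure have the same null
    sets.\<close>
  then have f'_0: "AE x in lborel. f' x = 0"
    unfolding F_def by (subst (asm) AE_density) (auto simp: score_def f_pos)
  have le_eq: "f b = f a" if "a \<le> b" for a b
  proof -
    have "(\<integral>x. indicator {a..b} x *\<^sub>R f' x \<partial>lborel) = f b - f a"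
      using f_deriv f'_cont that
      by (intro integral_FTC_atLeastAtMost)
        (auto simp: has_real_derivative_iff_has_vector_derivative[symmetric]
          intro: has_field_derivative_at_within continuous_on_subset)
    moreover have "(\<integral>x. indicator {a..b} x *\<^sub>R f' x \<partial>lborel) = 0"
      using f'_0 by (intro integral_eq_zero_AE) auto
    ultimately show ?thesis by simp
  qed
  have const: "f x = f 0" for x
    using le_eq[of 0 x] le_eq[of x 0] by (metis linear)
  have "F = density lborel (\<lambda>_. ennreal (f 0))"
    unfolding F_def by (intro arg_cong[of _ _ "density lborel"] arg_cong[of _ _ ennreal] ext const)
  then have "emeasure F UNIV = ennreal (f 0) * emeasure lborel (UNIV :: real set)"
    by (simp add: emeasure_density nn_integral_cmult)
  then show False
    using F.emeasure_space_1 f_pos[of 0] by (simp add: ennreal_mult_top)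
qed

section \<open>Increments of the log density to second order\<close>

lemma ln_f_deriv: "((\<lambda>x. ln (f x)) has_real_derivative score x) (at x)"
  using f_pos[of x] f_deriv[of x] unfolding score_def
  by (auto intro!: derivative_eq_intros simp: field_simps)

lemma score_deriv: "(score has_real_derivative score' x) (at x)"
  unfolding score_def[abs_def] score'_def
  using f_deriv f'_deriv
  by (auto intro!: derivative_eq_intros simp: field_simps power2_eq_square)

lemma measurable_incr [measurable (raw)]:
  assumes [measurable]: "a \<in> borel_measurable M" "b \<in> borel_measurable M"
  shows "(\<lambda>x. incr (a x) (b x)) \<in> borel_measurable M"
  unfolding incr_def by measurable

lemma C_nonneg: "0 \<le> C"
  using score_lipschitz by (rule lipschitz_on_nonneg)

text \<open>As a function of the increment, the remainder has derivative
  \<open>score (u + x) - score u\<close>, at most C |h| on the ball of radius |h|. The mean value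
  inequality loses a factor 2 against the sharp constant, which is harmless for domination.\<close>

lemma incr_remainder_bound: "\<bar>incr u h - h * score u\<bar> \<le> C * h\<^sup>2"
proof -
  let ?p = "\<lambda>x. ln (f (u + x)) - x * score u"
  have "norm (?p h - ?p 0) \<le> (C * \<bar>h\<bar>) * norm (h - 0)"
  proof (rule field_differentiable_bound[where S = "cball 0 \<bar>h\<bar>"])
    fix x :: real assume x: "x \<in> cball 0 \<bar>h\<bar>"
    have "((\<lambda>x. ln (f (u + x))) has_real_derivative score (u + x) * 1) (at x)"
      by (rule DERIV_chain2[OF ln_f_deriv]) (auto intro!: derivative_eq_intros)
    then show "(?p has_real_derivative score (u + x) - score u) (at x within cball 0 \<bar>h\<bar>)"
      using DERIV_diff[OF _ DERIV_cmult_right[OF DERIV_ident], of "\<lambda>x. ln (f (u + x))"]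
      by (auto intro: has_field_derivative_at_within)
    have "dist (score (u + x)) (score u) \<le> C * dist (u + x) u"
      using score_lipschitz unfolding score_def[abs_def] by (rule lipschitz_onD) auto
    also have "\<dots> \<le> C * \<bar>h\<bar>"
      using x C_nonneg by (intro mult_left_mono) (auto simp: dist_norm)
    finally show "norm (score (u + x) - score u) \<le> C * \<bar>h\<bar>"
      by (simp add: dist_norm)
  qed auto
  then show ?thesis
    by (simp add: incr_def power2_eq_square algebra_simps)
qed

text \<open>One application of l'Hopital suffices: the differentiated quotient is z / 2 times a
  difference quotient of s \<mapsto> \<open>score (u + s * z)\<close> at 0.\<close>

lemma incr_second_order:
  "((\<lambda>s. (incr u (s * z) - s * z * score u) / s\<^sup>2) \<longlongrightarrow> z\<^sup>2 * score' u / 2) (at_right 0)"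
proof (rule lhopital_right_0[where f' = "\<lambda>s. z * (score (u + s * z) - score u)" and g' = "\<lambda>s. 2 * s"])
  have deriv: "((\<lambda>s. incr u (s * z) - s * z * score u) has_real_derivative
      z * (score (u + s * z) - score u)) (at s)" for s
  proof -
    have "((\<lambda>s. ln (f (u + s * z))) has_real_derivative score (u + s * z) * z) (at s)"
      by (rule DERIV_chain2[OF ln_f_deriv]) (auto intro!: derivative_eq_intros)
    then show ?thesis
      using DERIV_diff[OF DERIV_diff[OF _ DERIV_const] DERIV_cmult_right[OF DERIV_ident, of "z * score u"],
          of "\<lambda>s. ln (f (u + s * z))" _ s UNIV "ln (f u)"]
      unfolding incr_def by (auto simp: algebra_simps)
  qed
  then show "\<forall>\<^sub>F s in at_right 0. ((\<lambda>s. incr u (s * z) - s * z * score u) has_real_derivative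
      z * (score (u + s * z) - score u)) (at s)"
    by simp
  have "isCont (\<lambda>s. incr u (s * z) - s * z * score u) 0"
    using deriv by (rule DERIV_isCont)
  then show "((\<lambda>s. incr u (s * z) - s * z * score u) \<longlongrightarrow> 0) (at_right 0)"
    by (auto simp: isCont_def incr_def intro: filterlim_mono[OF _ order_refl at_le])
  show "((\<lambda>s::real. s\<^sup>2) \<longlongrightarrow> 0) (at_right 0)"
    by (auto intro!: tendsto_eq_intros)
  show "\<forall>\<^sub>F s::real in at_right 0. s\<^sup>2 \<noteq> 0" "\<forall>\<^sub>F s::real in at_right 0. 2 * s \<noteq> 0"
    by (auto simp: eventually_at_filter)
  show "\<forall>\<^sub>F s::real in at_right 0. ((\<lambda>s. s\<^sup>2) has_real_derivative 2 * s) (at s)"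
    by (auto intro!: derivative_eq_intros always_eventually)
  have "((\<lambda>s. score (u + s * z)) has_real_derivative score' (u + 0 * z) * z) (at 0)"
    by (rule DERIV_chain2[OF score_deriv]) (auto intro!: derivative_eq_intros)
  then have "((\<lambda>s. (score (u + s * z) - score u) / s) \<longlongrightarrow> score' u * z) (at 0)"
    by (simp add: DERIV_def)
  then have "((\<lambda>s. z / 2 * ((score (u + s * z) - score u) / s)) \<longlongrightarrow> z / 2 * (score' u * z)) (at_right 0)"
    by (intro tendsto_mult_left) (auto intro: filterlim_mono[OF _ order_refl at_le])
  then show "((\<lambda>s. z * (score (u + s * z) - score u) / (2 * s)) \<longlongrightarrow> z\<^sup>2 * score' u / 2) (at_right 0)"
    by (simp add: power2_eq_square mult_ac)
qed


lemma moments_N: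
  "integrable std_normal_distribution (\<lambda>z. z)" "(\<integral>z. z \<partial>std_normal_distribution) = 0"
  "integrable std_normal_distribution (\<lambda>z. z\<^sup>2)" "(\<integral>z. z\<^sup>2 \<partial>std_normal_distribution) = 1"
  "integrable std_normal_distribution (\<lambda>z. z ^ 4)"
  using integrable_std_normal_distribution_moment[of 1] integral_std_normal_distribution_moment_odd[of 1]
    integrable_std_normal_distribution_moment[of 2] std_normal_distribution_even_moments(1)[of 1]
    integrable_std_normal_distribution_moment[of 4]
  by (simp_all add: fact_numeral)

text \<open>The exact first-order term \<open>i t s z score u\<close> is removed because it has mean zero but is
  too large for domination after division by \<open>s\<^sup>2\<close>.\<close>

definition expansion :: "real \<Rightarrow> real \<Rightarrow> real \<times> real \<Rightarrow> complex" where
  "expansion t s w = (iexp (t * incr (fst w) (s * snd w)) - 1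
     - \<i> * of_real (t * s * (score (fst w) * snd w))) / of_real (s\<^sup>2)"

lemma measurable_expansion [measurable]:
  "expansion t s \<in> borel_measurable (F \<Otimes>\<^sub>M std_normal_distribution)"
  unfolding expansion_def[abs_def] by measurable

lemma integral_expansion:
  assumes "0 < s"
  shows "integral\<^sup>L (F \<Otimes>\<^sub>M std_normal_distribution) (expansion t s) = (step_char t s - 1) / of_real (s\<^sup>2)"
proof -
  let ?P = "F \<Otimes>\<^sub>M std_normal_distribution"
  have 1: "integrable ?P (\<lambda>w. iexp (t * incr (fst w) (s * snd w)))"
    by (rule FN.P.integrable_const_bound[where B = 1]) (auto simp del: of_real_mult)
  note prod = FN.product_function_integral[OF integrable_score moments_N(1)]
  have 2: "integrable ?P (\<lambda>w. \<i> * complex_of_real (t * s * (score (fst w) * snd w)))"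
    using prod(1) by (intro integrable_mult_right integrable_of_real)
  have "(\<integral>w. \<i> * complex_of_real (t * s * (score (fst w) * snd w)) \<partial>?P) = 0"
    using prod(2) moments_N(2) by (simp only: integral_mult_right_zero integral_complex_of_real) simp
  with 1 2 show ?thesis
    unfolding expansion_def[abs_def] step_char_def
    by (simp add: Bochner_Integration.integral_diff FN.P.prob_space)
qed

text \<open>Separates the drift \<open>b\<close>, which is bounded and convergent after the division
  by s^2, from the second-order remainder of the exponential. The second identity shows that the
  argument \<open>x\<close> is of order s, so that this remainder also survives the
  division.\<close>

lemma expansion_alt:
  fixes s t u z b x :: real
  assumes "s \<noteq> 0" and b: "b = (incr u (s * z) - s * z * score u) / s\<^sup>2" and x: "x = t * incr u (s * z)"
  shows "expansion t s (u, z) = \<i> * of_real (t * b) + (iexp x - 1 - \<i> * of_real x) / of_real (s\<^sup>2)"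
    and "x = t * s * (z * score u + s * b)"
proof -
  have incr: "incr u (s * z) = s * (z * score u) + s\<^sup>2 * b"
    using \<open>s \<noteq> 0\<close> by (simp add: b)
  then have x_eq: "x = t * s * (score u * z) + s\<^sup>2 * (t * b)"
    by (simp add: x algebra_simps)
  then have eq: "complex_of_real x = of_real (t * s * (score u * z)) + of_real (s\<^sup>2) * of_real (t * b)"
    by (simp only: of_real_add of_real_mult)
  \<comment> \<open>An identity between abstract complex numbers, which keeps the
    \<open>of_real\<close> terms opaque to the simplifier.\<close>
  have alg: "(E - 1 - \<i> * p) / q = \<i> * r + (E - 1 - \<i> * y) / q"
    if "y = p + q * r" "q \<noteq> 0" for E p q r y :: complex
    using that by (simp add: field_simps)
  show "expansion t s (u, z) = \<i> * of_real (t * b) + (iexp x - 1 - \<i> * of_real x) / of_real (s\<^sup>2)"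
    unfolding expansion_def fst_conv snd_conv x[symmetric]
    by (rule alg[OF eq]) (use \<open>s \<noteq> 0\<close> in simp)
  show "x = t * s * (z * score u + s * b)"
    using x_eq by (simp add: power2_eq_square algebra_simps)
qed

text \<open>The bound is free of s and asks only for the second moment of the score and the fourth
  moment of z. The restriction to s at most 1 allows \<open>s * b\<close> to be bounded by
  \<open>b\<close>.\<close>

lemma expansion_bound:
  assumes s: "0 < s" "s \<le> 1"
  shows "norm (expansion t s (u, z))
    \<le> \<bar>t\<bar> * C * z\<^sup>2 + t\<^sup>2 * ((score u)\<^sup>2 * z\<^sup>2 + C\<^sup>2 * z ^ 4)"
proof -
  define b where "b = (incr u (s * z) - s * z * score u) / s\<^sup>2"
  define x where "x = t * incr u (s * z)"
  have alt: "expansion t s (u, z) = \<i> * of_real (t * b) + (iexp x - 1 - \<i> * of_real x) / of_real (s\<^sup>2)"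
    "x = t * s * (z * score u + s * b)"
    using expansion_alt[OF _ b_def x_def] s by auto
  have b: "\<bar>b\<bar> \<le> C * z\<^sup>2"
    using incr_remainder_bound[of u "s * z"] s
    by (simp add: b_def power_mult_distrib pos_divide_le_eq mult_ac)
  have "norm (iexp x - 1 - \<i> * of_real x) \<le> x\<^sup>2 / 2"
    using iexp_approx1[of x 1] by (simp add: diff_diff_eq power2_eq_square)
  also have "x\<^sup>2 / 2 = s\<^sup>2 * (t\<^sup>2 * ((z * score u + s * b)\<^sup>2 / 2))"
    by (simp add: alt(2) power_mult_distrib)
  also have "\<dots> \<le> s\<^sup>2 * (t\<^sup>2 * ((score u)\<^sup>2 * z\<^sup>2 + C\<^sup>2 * z ^ 4))"
  proof (intro mult_left_mono)
    have "\<bar>s * b\<bar> \<le> 1 * \<bar>b\<bar>"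
      using s unfolding abs_mult by (intro mult_right_mono) auto
    with b have "(s * b)\<^sup>2 \<le> (C * z\<^sup>2)\<^sup>2"
      by (intro power2_le_iff_abs_le[THEN iffD2]) (auto simp: C_nonneg)
    then have "(s * b)\<^sup>2 \<le> C\<^sup>2 * z ^ 4"
      by (simp add: power_mult_distrib)
    moreover have "(z * score u + s * b)\<^sup>2 / 2 \<le> (score u)\<^sup>2 * z\<^sup>2 + (s * b)\<^sup>2"
      using sum_squares_bound[of "z * score u" "s * b"]
      by (simp add: power2_sum power_mult_distrib mult_ac)
    ultimately show "(z * score u + s * b)\<^sup>2 / 2 \<le> (score u)\<^sup>2 * z\<^sup>2 + C\<^sup>2 * z ^ 4"
      by linarith
  qed auto
  finally have "norm (iexp x - 1 - \<i> * of_real x) \<le> s\<^sup>2 * (t\<^sup>2 * ((score u)\<^sup>2 * z\<^sup>2 + C\<^sup>2 * z ^ 4))" .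
  then have "norm ((iexp x - 1 - \<i> * of_real x) / of_real (s\<^sup>2)) \<le> t\<^sup>2 * ((score u)\<^sup>2 * z\<^sup>2 + C\<^sup>2 * z ^ 4)"
    using s by (simp add: norm_divide norm_power pos_divide_le_eq mult_ac)
  moreover have "norm (\<i> * complex_of_real (t * b)) \<le> \<bar>t\<bar> * C * z\<^sup>2"
    using mult_left_mono[OF b, of "\<bar>t\<bar>"] by (simp add: norm_mult abs_mult mult_ac)
  ultimately show ?thesis
    unfolding alt(1) by (intro norm_triangle_le) linarith
qed

text \<open>The drift from the second-order term of ln f, minus half the square of its first-order
  term.\<close>

definition expansion_limit :: "real \<Rightarrow> real \<times> real \<Rightarrow> complex" where
  "expansion_limit t w = \<i> * of_real (t / 2 * (score' (fst w) * (snd w)\<^sup>2))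
     - of_real (t\<^sup>2 / 2 * ((score (fst w))\<^sup>2 * (snd w)\<^sup>2))"

lemma measurable_expansion_limit [measurable]:
  "expansion_limit t \<in> borel_measurable (F \<Otimes>\<^sub>M std_normal_distribution)"
  unfolding expansion_limit_def[abs_def] by measurable

lemma expansion_tendsto: "((\<lambda>s. expansion t s (u, z)) \<longlongrightarrow> expansion_limit t (u, z)) (at_right 0)"
proof -
  define b where "b s = (incr u (s * z) - s * z * score u) / s\<^sup>2" for s
  define a where "a s = z * score u + s * b s" for s
  \<comment> \<open>What remains of the exponential beyond its quadratic term; being at most |x|^3 /
    (6 s^2) with x of order s, it is O(s).\<close>
  define r where "r s = (iexp (t * s * a s) - 1 - \<i> * (t * s * a s)) / of_real (s\<^sup>2) + of_real (t\<^sup>2 * (a s)\<^sup>2 / 2)" for s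
  have b: "(b \<longlongrightarrow> z\<^sup>2 * score' u / 2) (at_right 0)"
    unfolding b_def by (rule incr_second_order)
  have "((\<lambda>s. z * score u + s * b s) \<longlongrightarrow> z * score u + 0 * (z\<^sup>2 * score' u / 2)) (at_right 0)"
    by (intro tendsto_intros b)
  then have a: "(a \<longlongrightarrow> z * score u) (at_right 0)"
    by (simp add: a_def[abs_def])
  have r_bound: "norm (r s) \<le> \<bar>t\<bar> ^ 3 * \<bar>a s\<bar> ^ 3 * \<bar>s\<bar> / 6" if "0 < s" for s
  proof -
    define x where "x = t * s * a s"
    have "norm (iexp x - 1 - \<i> * of_real x + x\<^sup>2 / 2) \<le> \<bar>x\<bar> ^ 3 / 6"
      using iexp_approx1[of x 2]
      by (simp add: numeral_2_eq_2 numeral_3_eq_3 algebra_simps power_mult_distrib fact_numeral)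
    moreover have "r s = (iexp x - 1 - \<i> * of_real x + x\<^sup>2 / 2) / of_real (s\<^sup>2)"
      using that by (simp add: r_def x_def power_mult_distrib field_simps)
    ultimately have "norm (r s) \<le> \<bar>x\<bar> ^ 3 / 6 / s\<^sup>2"
      using divide_right_mono[of "norm (iexp x - 1 - \<i> * of_real x + x\<^sup>2 / 2)" "\<bar>x\<bar> ^ 3 / 6" "s\<^sup>2"]
      by (simp only: norm_divide norm_of_real abs_power2) simp
    also have "\<bar>x\<bar> ^ 3 / 6 / s\<^sup>2 = \<bar>t\<bar> ^ 3 * \<bar>a s\<bar> ^ 3 * \<bar>s\<bar> / 6"
    proof -
      have "\<bar>x\<bar> ^ 3 = \<bar>t\<bar> ^ 3 * \<bar>a s\<bar> ^ 3 * s ^ 3"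
        using that by (simp add: x_def abs_mult power_mult_distrib)
      then show ?thesis
        using that by (simp add: power3_eq_cube[of s] power2_eq_square[of s])
    qed
    finally show ?thesis .
  qed
  have "((\<lambda>s. \<bar>t\<bar> ^ 3 * \<bar>a s\<bar> ^ 3 * \<bar>s\<bar> / 6) \<longlongrightarrow> \<bar>t\<bar> ^ 3 * \<bar>z * score u\<bar> ^ 3 * \<bar>0\<bar> / 6) (at_right 0)"
    by (intro tendsto_intros a) auto
  then have "((\<lambda>s. \<bar>t\<bar> ^ 3 * \<bar>a s\<bar> ^ 3 * \<bar>s\<bar> / 6) \<longlongrightarrow> 0) (at_right 0)"
    by (simp only: abs_zero mult_zero_right div_0)
  moreover have "\<forall>\<^sub>F s in at_right 0. norm (r s) \<le> \<bar>t\<bar> ^ 3 * \<bar>a s\<bar> ^ 3 * \<bar>s\<bar> / 6"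
    using eventually_at_right_less by (rule eventually_mono) (rule r_bound)
  ultimately have r: "(r \<longlongrightarrow> 0) (at_right 0)"
    by (rule Lim_null_comparison[rotated])
  have "((\<lambda>s. \<i> * of_real (t * b s) + (r s - of_real (t\<^sup>2 * (a s)\<^sup>2 / 2))) \<longlongrightarrow>
      \<i> * of_real (t * (z\<^sup>2 * score' u / 2)) + (0 - of_real (t\<^sup>2 * (z * score u)\<^sup>2 / 2))) (at_right 0)"
    by (intro tendsto_intros a b r) simp_all
  also have "\<i> * of_real (t * (z\<^sup>2 * score' u / 2)) + (0 - of_real (t\<^sup>2 * (z * score u)\<^sup>2 / 2)) =
      expansion_limit t (u, z)"
    by (simp add: expansion_limit_def power_mult_distrib mult_ac)
  finally show ?thesis
  proof (rule tendsto_cong[THEN iffD1, rotated])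
    have "\<i> * of_real (t * b s) + (r s - of_real (t\<^sup>2 * (a s)\<^sup>2 / 2)) = expansion t s (u, z)" if "0 < s" for s
      using expansion_alt[OF _ b_def refl, of s t] that by (simp add: r_def a_def[symmetric])
    then show "\<forall>\<^sub>F s in at_right 0.
        \<i> * of_real (t * b s) + (r s - of_real (t\<^sup>2 * (a s)\<^sup>2 / 2)) = expansion t s (u, z)"
      by (auto simp: eventually_at_filter)
  qed
qed

text \<open>The exponent in the characteristic function of the normal law with mean
  -\<open>fisher\<close>/2 and variance \<open>fisher\<close>.\<close>

definition log_char :: "real \<Rightarrow> complex" where
  "log_char t = of_real (- (fisher / 2)) * (of_real (t\<^sup>2) + \<i> * of_real t)"

lemma integral_expansion_limit:
  "integral\<^sup>L (F \<Otimes>\<^sub>M std_normal_distribution) (expansion_limit t) = log_char t"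
proof -
  note p1 = FN.product_function_integral[OF integrable_score' moments_N(3)]
    and p2 = FN.product_function_integral[OF integrable_score_sq moments_N(3)]
  show ?thesis
    unfolding expansion_limit_def[abs_def]
    using p1 p2 integral_score' moments_N(4)
    by (subst Bochner_Integration.integral_diff)
      (simp_all add: fisher_def[symmetric] log_char_def algebra_simps del: of_real_mult of_real_divide of_real_power, simp_all add: field_simps)
qed

lemma step_char_second_order:
  "((\<lambda>s. (step_char t s - 1) / of_real (s\<^sup>2)) \<longlongrightarrow> log_char t) (at_right 0)"
proof -
  let ?P = "F \<Otimes>\<^sub>M std_normal_distribution"
  \<comment> \<open>Dominated convergence is sequential; approaching 0 inside {0..1} keeps every
    term of the sequence in the range of \<open>expansion_bound\<close>.\<close>
  have "((\<lambda>s. integral\<^sup>L ?P (expansion t s)) \<longlongrightarrow> integral\<^sup>L ?P (expansion_limit t)) (at 0 within {0..1})"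
    unfolding tendsto_at_iff_sequentially comp_def
  proof (intro allI impI)
    fix X :: "nat \<Rightarrow> real" assume X: "\<forall>i. X i \<in> {0..1} - {0}" "X \<longlonglongrightarrow> 0"
    then have X_pos: "0 < X i" "X i \<le> 1" for i
      by (auto simp: less_le)
    have X_right: "filterlim X (at_right 0) sequentially"
      using X X_pos by (auto simp: filterlim_at)
    show "(\<lambda>i. integral\<^sup>L ?P (expansion t (X i))) \<longlonglongrightarrow> integral\<^sup>L ?P (expansion_limit t)"
    proof (rule integral_dominated_convergence)
      \<comment> \<open>The factors 1 give every summand the product shape required by
        \<open>product_function_integral\<close>.\<close>
      show "integrable ?P (\<lambda>w. \<bar>t\<bar> * C * (1 * (snd w)\<^sup>2)
          + t\<^sup>2 * ((score (fst w))\<^sup>2 * (snd w)\<^sup>2 + C\<^sup>2 * (1 * snd w ^ 4)))"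
        by (intro Bochner_Integration.integrable_add integrable_mult_right
            FN.product_function_integral(1) integrable_score_sq moments_N F.integrable_const)
      show "AE w in ?P. (\<lambda>i. expansion t (X i) w) \<longlonglongrightarrow> expansion_limit t w"
        using filterlim_compose[OF expansion_tendsto X_right] by auto
      show "AE w in ?P. norm (expansion t (X i) w) \<le> \<bar>t\<bar> * C * (1 * (snd w)\<^sup>2)
          + t\<^sup>2 * ((score (fst w))\<^sup>2 * (snd w)\<^sup>2 + C\<^sup>2 * (1 * snd w ^ 4))" for i
        using expansion_bound[OF X_pos] by auto
    qed measurable
  qed
  then have "((\<lambda>s. integral\<^sup>L ?P (expansion t s)) \<longlongrightarrow> log_char t) (at_right 0)"
    by (simp add: at_within_Icc_at_right integral_expansion_limit)
  then show ?thesis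
    by (rule tendsto_cong[THEN iffD1, rotated]) (auto simp: eventually_at_filter integral_expansion)
qed

end

lemma exp_first_order:
  fixes w :: complex
  shows "((\<lambda>s::real. (exp (of_real (s\<^sup>2) * w) - 1) / of_real (s\<^sup>2)) \<longlongrightarrow> w) (at_right 0)"
proof -
  have "((\<lambda>z. exp (z * w)) has_field_derivative w) (at 0)"
    by (auto intro!: derivative_eq_intros)
  then have "((\<lambda>z. (exp (z * w) - 1) / z) \<longlongrightarrow> w) (at 0)"
    by (simp add: DERIV_def)
  moreover have "filterlim (\<lambda>s::real. complex_of_real (s\<^sup>2)) (at 0) (at_right 0)"
    by (rule filterlim_atI) (auto intro!: tendsto_eq_intros simp: eventually_at_filter)
  ultimately show ?thesis
    by (rule filterlim_compose)
qed

section \<open>From one factor to products over a triangular array\<close>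

context smooth_density begin

lemma norm_step_char: "norm (step_char t s) \<le> 1"
proof -
  have "norm (step_char t s)
      \<le> (\<integral>w. norm (iexp (t * incr (fst w) (s * snd w))) \<partial>(F \<Otimes>\<^sub>M std_normal_distribution))"
    unfolding step_char_def by (rule integral_norm_bound)
  also have "\<dots> = 1"
    by (simp add: FN.P.prob_space del: of_real_mult)
  finally show ?thesis .
qed

lemma norm_exp_log_char: "0 \<le> r \<Longrightarrow> norm (exp (of_real r * log_char t)) \<le> 1"
  using fisher_pos by (simp add: log_char_def mult_nonneg_nonneg)

text \<open>Both functions equal 1 at s = 0 and have the same limit \<open>log_char t\<close> after
  subtracting 1 and dividing by s^2. The error is stated relative to s^2 so that it can be summed
  over coordinates.\<close>

lemma step_char_close:
  assumes "0 < e"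
  obtains \<delta> where "0 < \<delta>"
    "\<And>s. 0 \<le> s \<Longrightarrow> s < \<delta> \<Longrightarrow> norm (step_char t s - exp (of_real (s\<^sup>2) * log_char t)) \<le> e * s\<^sup>2"
proof -
  have "((\<lambda>s. (step_char t s - 1) / of_real (s\<^sup>2) - (exp (of_real (s\<^sup>2) * log_char t) - 1) / of_real (s\<^sup>2))
      \<longlongrightarrow> log_char t - log_char t) (at_right 0)"
    by (intro tendsto_diff step_char_second_order exp_first_order)
  then have "\<forall>\<^sub>F s in at_right 0. norm ((step_char t s - 1) / of_real (s\<^sup>2)
      - (exp (of_real (s\<^sup>2) * log_char t) - 1) / of_real (s\<^sup>2)) < e"
    using assms by (simp add: tendsto_iff dist_norm)
  then obtain \<delta> where \<delta>: "0 < \<delta>" "\<And>s. 0 < s \<Longrightarrow> s < \<delta> \<Longrightarrow>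
      norm ((step_char t s - 1) / of_real (s\<^sup>2) - (exp (of_real (s\<^sup>2) * log_char t) - 1) / of_real (s\<^sup>2)) < e"
    unfolding eventually_at_right_field by auto
  show ?thesis
  proof (rule that[OF \<delta>(1)])
    fix s :: real assume s: "0 \<le> s" "s < \<delta>"
    show "norm (step_char t s - exp (of_real (s\<^sup>2) * log_char t)) \<le> e * s\<^sup>2"
    proof (cases "s = 0")
      case True
      then show ?thesis
        by (simp add: step_char_def incr_def FN.P.prob_space)
    next
      case False
      have "norm ((step_char t s - exp (of_real (s\<^sup>2) * log_char t)) / of_real (s\<^sup>2)) < e"
        using \<delta>(2)[of s] s False by (simp add: diff_divide_distrib)
      then show ?thesis
        using False by (simp add: norm_divide norm_power pos_divide_less_eq)
    qed
  qed
qed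

text \<open>All factors lie in the closed unit disc, so the two products differ by at most the sum
  of the factor errors, which is a small multiple of the bounded sum of squares. No relation between
  the steps of one row is assumed.\<close>

lemma prod_step_char_tendsto:
  fixes I :: "nat \<Rightarrow> 'i set" and s :: "nat \<Rightarrow> 'i \<Rightarrow> real"
  assumes s_nonneg: "\<And>k j. j \<in> I k \<Longrightarrow> 0 \<le> s k j"
    and s_small: "\<And>e. 0 < e \<Longrightarrow> \<forall>\<^sub>F k in sequentially. \<forall>j\<in>I k. s k j < e"
    and s_sum: "(\<lambda>k. \<Sum>j\<in>I k. (s k j)\<^sup>2) \<longlonglongrightarrow> V"
  shows "(\<lambda>k. \<Prod>j\<in>I k. step_char t (s k j)) \<longlonglongrightarrow> exp (of_real V * log_char t)"
proof -
  let ?E = "\<lambda>k. exp (of_real (\<Sum>j\<in>I k. (s k j)\<^sup>2) * log_char t)"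
  have prod_exp: "?E k = (\<Prod>j\<in>I k. exp (of_real ((s k j)\<^sup>2) * log_char t))" for k
  \<comment> \<open>For infinite \<open>I k\<close> the sum defaults to 0 and the product to 1, so
    the identity persists.\<close>
  proof (cases "finite (I k)")
    case True
    then show ?thesis
      by (simp add: exp_sum sum_distrib_right)
  qed simp
  have "0 \<le> V"
    using s_sum by (rule tendsto_lowerbound) (auto intro!: always_eventually sum_nonneg)
  have "(\<lambda>k. (\<Prod>j\<in>I k. step_char t (s k j)) - ?E k) \<longlonglongrightarrow> 0"
  proof (rule tendstoI)
    fix e :: real assume "0 < e"
    \<comment> \<open>The sum of squares is eventually below \<open>V + 1\<close>, so the total
      error is at most e / 2.\<close>
    define e' where "e' = e / (2 * (V + 1))"
    have "0 < e'" using \<open>0 < e\<close> \<open>0 \<le> V\<close> by (simp add: e'_def)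
    then obtain \<delta> where \<delta>: "0 < \<delta>"
      "\<And>s. 0 \<le> s \<Longrightarrow> s < \<delta> \<Longrightarrow> norm (step_char t s - exp (of_real (s\<^sup>2) * log_char t)) \<le> e' * s\<^sup>2"
      using step_char_close[of e' t] by blast
    have "\<forall>\<^sub>F k in sequentially. (\<Sum>j\<in>I k. (s k j)\<^sup>2) < V + 1"
      using s_sum by (rule order_tendstoD) simp
    with s_small[OF \<delta>(1)] show "\<forall>\<^sub>F k in sequentially. dist ((\<Prod>j\<in>I k. step_char t (s k j)) - ?E k) 0 < e"
    proof eventually_elim
      case (elim k)
      have "norm ((\<Prod>j\<in>I k. step_char t (s k j)) - ?E k)
          \<le> (\<Sum>j\<in>I k. norm (step_char t (s k j) - exp (of_real ((s k j)\<^sup>2) * log_char t)))"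
        unfolding prod_exp by (rule norm_prod_diff) (intro norm_step_char norm_exp_log_char zero_le_power2)+
      also have "\<dots> \<le> (\<Sum>j\<in>I k. e' * (s k j)\<^sup>2)"
        using elim s_nonneg by (intro sum_mono \<delta>(2)) auto
      also have "\<dots> = e' * (\<Sum>j\<in>I k. (s k j)\<^sup>2)"
        by (simp add: sum_distrib_left)
      also have "\<dots> \<le> e' * (V + 1)"
        using elim \<open>0 < e'\<close> by (intro mult_left_mono) auto
      also have "e' * (V + 1) = e / 2"
        using \<open>0 \<le> V\<close> unfolding e'_def by (simp del: distrib_left_numeral)
      also have "\<dots> < e"
        using \<open>0 < e\<close> by simp
      finally show ?case by simp
    qed
  qed
  moreover have "?E \<longlonglongrightarrow> exp (of_real V * log_char t)"
    by (intro tendsto_intros s_sum)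
  ultimately have "(\<lambda>k. ((\<Prod>j\<in>I k. step_char t (s k j)) - ?E k) + ?E k) \<longlonglongrightarrow> 0 + exp (of_real V * log_char t)"
    by (rule tendsto_add)
  then show ?thesis by simp
qed

end

section \<open>The law of the log acceptance ratio\<close>

text \<open>The states and the proposals form two separate product spaces, whereas the integrand
  factors over pairs of coordinates. Fubini for the pair, with the product formula applied first in
  y and then in x, reconciles the two. The value type covers both real densities and complex
  characteristic functions.\<close>

lemma pair_PiM_integral_prod:
  fixes h :: "'i \<Rightarrow> real \<Rightarrow> real \<Rightarrow> 'b :: {real_normed_field, banach, second_countable_topology}"
  assumes "finite I"
    and meas: "\<And>j. j \<in> I \<Longrightarrow> (\<lambda>w. h j (fst w) (snd w)) \<in> borel_measurable (lborel \<Otimes>\<^sub>M lborel)"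
    and inner: "\<And>j x. j \<in> I \<Longrightarrow> integrable lborel (h j x)"
    and outer: "\<And>j. j \<in> I \<Longrightarrow> integrable lborel (\<lambda>x. \<integral>y. norm (h j x y) \<partial>lborel)"
  shows "integrable (PiM I (\<lambda>_. lborel) \<Otimes>\<^sub>M PiM I (\<lambda>_. lborel)) (\<lambda>w. \<Prod>j\<in>I. h j (fst w j) (snd w j))"
      (is "integrable (?M \<Otimes>\<^sub>M ?M) ?h")
    and "(\<integral>w. (\<Prod>j\<in>I. h j (fst w j) (snd w j)) \<partial>(PiM I (\<lambda>_. lborel) \<Otimes>\<^sub>M PiM I (\<lambda>_. lborel)))
      = (\<Prod>j\<in>I. \<integral>x. (\<integral>y. h j x y \<partial>lborel) \<partial>lborel)"
proof -
  interpret product_sigma_finite "\<lambda>_ :: 'i. lborel :: real measure" ..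
  interpret sigma_finite_measure ?M by (rule sigma_finite) fact
  interpret P: pair_sigma_finite ?M ?M ..
  have comp: "(\<lambda>w. (fst w j, snd w j)) \<in> ?M \<Otimes>\<^sub>M ?M \<rightarrow>\<^sub>M lborel \<Otimes>\<^sub>M lborel" if "j \<in> I" for j
    using that by measurable
  have meas_h: "?h \<in> borel_measurable (?M \<Otimes>\<^sub>M ?M)"
    using measurable_compose[OF comp meas] by (intro borel_measurable_prod) simp
  have outer': "integrable lborel (\<lambda>x. \<integral>y. h j x y \<partial>lborel)" if "j \<in> I" for j
  proof (rule Bochner_Integration.integrable_bound[OF outer[OF that]])
    have "(\<lambda>(x, y). h j x y) \<in> borel_measurable (lborel \<Otimes>\<^sub>M lborel)"
      using meas[OF that] by (simp add: split_beta')
    then show "(\<lambda>x. \<integral>y. h j x y \<partial>lborel) \<in> borel_measurable lborel"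
      by (rule lborel.borel_measurable_lebesgue_integral)
    show "AE x in lborel. norm (\<integral>y. h j x y \<partial>lborel) \<le> norm (\<integral>y. norm (h j x y) \<partial>lborel)"
      by (auto intro!: always_eventually order_trans[OF integral_norm_bound])
  qed
  show int: "integrable (?M \<Otimes>\<^sub>M ?M) ?h"
  proof (rule P.Fubini_integrable[OF meas_h])
    have "(\<integral>y. norm (?h (x, y)) \<partial>?M) = (\<Prod>j\<in>I. \<integral>y. norm (h j (x j) y) \<partial>lborel)" for x
      using product_integral_prod[OF \<open>finite I\<close>, of "\<lambda>j y. norm (h j (x j) y)"] inner
      by (simp add: prod_norm[symmetric])
    moreover have "integrable ?M (\<lambda>x. \<Prod>j\<in>I. \<integral>y. norm (h j (x j) y) \<partial>lborel)"
      by (rule product_integrable_prod[OF \<open>finite I\<close> outer])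
    ultimately show "integrable ?M (\<lambda>x. \<integral>y. norm (?h (x, y)) \<partial>?M)"
      by simp
    show "AE x in ?M. integrable ?M (\<lambda>y. ?h (x, y))"
      using inner by (auto intro!: always_eventually product_integrable_prod[OF \<open>finite I\<close>])
  qed
  have "integral\<^sup>L (?M \<Otimes>\<^sub>M ?M) ?h = (\<integral>x. (\<Prod>j\<in>I. \<integral>y. h j (x j) y \<partial>lborel) \<partial>?M)"
  proof -
    have "(\<integral>y. (\<Prod>j\<in>I. h j (x j) (y j)) \<partial>?M) = (\<Prod>j\<in>I. \<integral>y. h j (x j) y \<partial>lborel)" for x
      by (rule product_integral_prod[OF \<open>finite I\<close> inner])
    then show ?thesis
      using P.integral_fst'[OF int] by simp
  qed
  also have "\<dots> = (\<Prod>j\<in>I. \<integral>x. (\<integral>y. h j x y \<partial>lborel) \<partial>lborel)"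
    by (rule product_integral_prod[OF \<open>finite I\<close> outer'])
  finally show "integral\<^sup>L (?M \<Otimes>\<^sub>M ?M) ?h = (\<Prod>j\<in>I. \<integral>x. (\<integral>y. h j x y \<partial>lborel) \<partial>lborel)" .
qed

context smooth_density begin

definition coord_density :: "real \<Rightarrow> real \<Rightarrow> real \<Rightarrow> real \<Rightarrow> real" where
  "coord_density c \<sigma> x y = c * f (c * x) * normal_density x \<sigma> y"

lemma coord_density_nonneg: "0 < c \<Longrightarrow> 0 \<le> coord_density c \<sigma> x y"
  by (simp add: coord_density_def)

lemma measurable_coord_density [measurable (raw)]:
  assumes [measurable]: "a \<in> borel_measurable M" "b \<in> borel_measurable M"
  shows "(\<lambda>w. coord_density c \<sigma> (a w) (b w)) \<in> borel_measurable M"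
  unfolding coord_density_def normal_density_def by measurable

lemma coord_density_integrable:
  assumes "0 < c" "0 < \<sigma>"
  shows "integrable lborel (coord_density c \<sigma> x)"
    and "(\<integral>y. coord_density c \<sigma> x y \<partial>lborel) = c * f (c * x)"
    and "integrable lborel (\<lambda>x. c * f (c * x))"
    and "(\<integral>x. c * f (c * x) \<partial>lborel) = 1"
proof -
  show "integrable lborel (coord_density c \<sigma> x)" "(\<integral>y. coord_density c \<sigma> x y \<partial>lborel) = c * f (c * x)"
    using assms by (auto simp: coord_density_def[abs_def])
  have f: "integrable lborel f" "integral\<^sup>L lborel f = 1"
    using integrable_F_iff[of "\<lambda>_. 1"] integral_F[of "\<lambda>_. 1"] F.prob_space by simp_all
  show "integrable lborel (\<lambda>x. c * f (c * x))"
    using assms lborel_integrable_real_affine[OF f(1), of c 0] by simp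
  show "(\<integral>x. c * f (c * x) \<partial>lborel) = 1"
    using assms lborel_integral_real_affine[of c f 0] f(2) by simp
qed

text \<open>Substituting y = x + \<sigma> z and then u = c x turns the proposal into a standard
  normal and the coordinate into \<open>F\<close>; the two scales survive only through their
  product.\<close>

lemma step_char_coord:
  assumes "0 < c" "0 < \<sigma>"
  shows "(\<integral>x. (\<integral>y. coord_density c \<sigma> x y *\<^sub>R iexp (t * incr (c * x) (c * (y - x))) \<partial>lborel) \<partial>lborel)
    = step_char t (c * \<sigma>)"
proof -
  define H where "H u = (\<integral>z. iexp (t * incr u (c * \<sigma> * z)) \<partial>std_normal_distribution)" for u
  have "(\<integral>y. coord_density c \<sigma> x y *\<^sub>R iexp (t * incr (c * x) (c * (y - x))) \<partial>lborel)
      = (c * f (c * x)) *\<^sub>R H (c * x)" for x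
  proof -
    have "(\<integral>y. coord_density c \<sigma> x y *\<^sub>R iexp (t * incr (c * x) (c * (y - x))) \<partial>lborel)
      = \<sigma> *\<^sub>R (\<integral>z. coord_density c \<sigma> x (x + \<sigma> * z) *\<^sub>R iexp (t * incr (c * x) (c * \<sigma> * z)) \<partial>lborel)"
      using \<open>0 < \<sigma>\<close> by (subst lborel_integral_real_affine[of \<sigma> _ x]) (auto simp: mult_ac)
    also have "\<dots> = (\<integral>z. \<sigma> *\<^sub>R (coord_density c \<sigma> x (x + \<sigma> * z) *\<^sub>R iexp (t * incr (c * x) (c * \<sigma> * z))) \<partial>lborel)"
      by (rule integral_scaleR_right[symmetric])
    also have "\<dots> = (\<integral>z. (c * f (c * x)) *\<^sub>R (std_normal_density z *\<^sub>R iexp (t * incr (c * x) (c * \<sigma> * z))) \<partial>lborel)"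
    proof -
      have "\<sigma> * coord_density c \<sigma> x (x + \<sigma> * z) = c * f (c * x) * std_normal_density z" for z
        using \<open>0 < \<sigma>\<close> by (simp add: coord_density_def normal_density_def power_mult_distrib real_sqrt_mult)
      then show ?thesis
        by (simp only: scaleR_scaleR)
    qed
    also have "\<dots> = (c * f (c * x)) *\<^sub>R (\<integral>z. std_normal_density z *\<^sub>R iexp (t * incr (c * x) (c * \<sigma> * z)) \<partial>lborel)"
      by (rule integral_scaleR_right)
    also have "\<dots> = (c * f (c * x)) *\<^sub>R H (c * x)"
      unfolding H_def by (subst integral_density) auto
    finally show ?thesis .
  qed
  then have "(\<integral>x. (\<integral>y. coord_density c \<sigma> x y *\<^sub>R iexp (t * incr (c * x) (c * (y - x))) \<partial>lborel) \<partial>lborel)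
    = (\<integral>x. (c * f (c * x)) *\<^sub>R H (c * x) \<partial>lborel)"
    by simp
  \<comment> \<open>The \<open>0 +\<close> matches the form that the affine substitution with shift
    0 produces.\<close>
  also have "\<dots> = c *\<^sub>R (\<integral>x. f (0 + c * x) *\<^sub>R H (0 + c * x) \<partial>lborel)"
    by (simp flip: integral_scaleR_right)
  also have "\<dots> = (\<integral>u. f u *\<^sub>R H u \<partial>lborel)"
    using \<open>0 < c\<close> by (subst (2) lborel_integral_real_affine[of c _ 0]) auto
  also have "\<dots> = (\<integral>u. H u \<partial>F)"
    unfolding F_def H_def by (subst integral_density) auto
  also have "\<dots> = step_char t (c * \<sigma>)"
  proof -
    have "integrable (F \<Otimes>\<^sub>M std_normal_distribution) (\<lambda>w. iexp (t * incr (fst w) (c * \<sigma> * snd w)))"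
      by (rule FN.P.integrable_const_bound[where B = 1]) (auto simp del: of_real_mult)
    from FN.integral_fst'[OF this] show ?thesis
      by (simp add: H_def[abs_def] step_char_def)
  qed
  finally show ?thesis .
qed

end

definition step_size :: "real \<Rightarrow> real \<Rightarrow> nat \<Rightarrow> real" where
  "step_size \<alpha> l d = sqrt (l\<^sup>2 / real d powr \<alpha>)"

section \<open>State and proposal in a fixed dimension\<close>

context smooth_density begin

context
  fixes \<theta> :: "nat \<Rightarrow> nat \<Rightarrow> real" and \<alpha> l :: real and d :: nat
  assumes \<theta>_pos: "\<And>j. j \<in> {1..d} \<Longrightarrow> 0 < \<theta> j d" and l_pos: "0 < l" and d_pos: "0 < d"
begin

abbreviation \<sigma> :: real where "\<sigma> \<equiv> step_size \<alpha> l d"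

definition log_ratio :: "(nat \<Rightarrow> real) \<times> (nat \<Rightarrow> real) \<Rightarrow> real" where
  "log_ratio w = (\<Sum>j=1..d. incr (\<theta> j d * fst w j) (\<theta> j d * (snd w j - fst w j)))"

definition ratio_law :: "real measure" where
  "ratio_law = distr (joint_law f \<theta> \<alpha> d l) borel log_ratio"

lemma step_size_pos: "0 < \<sigma>"
  using l_pos d_pos by (simp add: step_size_def)

lemma joint_law_eq:
  "joint_law f \<theta> \<alpha> d l = density (euclid d \<Otimes>\<^sub>M euclid d)
     (\<lambda>w. ennreal (\<Prod>j\<in>{1..d}. coord_density (\<theta> j d) \<sigma> (fst w j) (snd w j)))"
  by (simp add: joint_law_def target_density_def coord_density_def step_size_def split_beta' prod.distrib)

lemma measurable_coord [measurable]:
  assumes "j \<in> {1..d}"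
  shows "(\<lambda>w. fst w j) \<in> borel_measurable (euclid d \<Otimes>\<^sub>M euclid d)"
    "(\<lambda>w. snd w j) \<in> borel_measurable (euclid d \<Otimes>\<^sub>M euclid d)"
  using assms unfolding euclid_def by measurable

lemma measurable_log_ratio [measurable]:
  "log_ratio \<in> borel_measurable (euclid d \<Otimes>\<^sub>M euclid d)"
  unfolding log_ratio_def[abs_def] by (intro borel_measurable_sum) measurable

lemma measurable_joint_density:
  "(\<lambda>w. \<Prod>j\<in>{1..d}. coord_density (\<theta> j d) \<sigma> (fst w j) (snd w j))
    \<in> borel_measurable (euclid d \<Otimes>\<^sub>M euclid d)"
  by (intro borel_measurable_prod) measurable

lemma joint_density_nonneg: "0 \<le> (\<Prod>j\<in>{1..d}. coord_density (\<theta> j d) \<sigma> (fst w j) (snd w j))"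
  by (intro prod_nonneg coord_density_nonneg \<theta>_pos) 

lemma joint_density_integral:
  shows "integrable (euclid d \<Otimes>\<^sub>M euclid d)
      (\<lambda>w. \<Prod>j\<in>{1..d}. coord_density (\<theta> j d) \<sigma> (fst w j) (snd w j))"
    and "(\<integral>w. (\<Prod>j\<in>{1..d}. coord_density (\<theta> j d) \<sigma> (fst w j) (snd w j)) \<partial>(euclid d \<Otimes>\<^sub>M euclid d)) = 1"
proof -
  have norm: "(\<integral>y. norm (coord_density (\<theta> j d) \<sigma> x y) \<partial>lborel) = \<theta> j d * f (\<theta> j d * x)"
    if "j \<in> {1..d}" for j x
    using coord_density_integrable(2)[OF \<theta>_pos[OF that] step_size_pos] coord_density_nonneg[OF \<theta>_pos[OF that]]
    by simp
  have one: "(\<integral>x. (\<integral>y. coord_density (\<theta> j d) \<sigma> x y \<partial>lborel) \<partial>lborel) = 1" if "j \<in> {1..d}" for j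
    using coord_density_integrable[OF \<theta>_pos[OF that] step_size_pos] by simp
  have meas: "(\<lambda>w. coord_density (\<theta> j d) \<sigma> (fst w) (snd w)) \<in> borel_measurable (lborel \<Otimes>\<^sub>M lborel)" for j
    by measurable
  have inner: "integrable lborel (coord_density (\<theta> j d) \<sigma> x)" if "j \<in> {1..d}" for j x
    using coord_density_integrable(1)[OF \<theta>_pos[OF that] step_size_pos] .
  have outer: "integrable lborel (\<lambda>x. \<integral>y. norm (coord_density (\<theta> j d) \<sigma> x y) \<partial>lborel)"
    if "j \<in> {1..d}" for j
    unfolding norm[OF that] by (rule coord_density_integrable(3)[OF \<theta>_pos[OF that] step_size_pos])
  note * = pair_PiM_integral_prod[where h = "\<lambda>j. coord_density (\<theta> j d) \<sigma>", OF _ meas inner outer]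
  show "integrable (euclid d \<Otimes>\<^sub>M euclid d)
      (\<lambda>w. \<Prod>j\<in>{1..d}. coord_density (\<theta> j d) \<sigma> (fst w j) (snd w j))"
    unfolding euclid_def by (rule *(1)) auto
  show "(\<integral>w. (\<Prod>j\<in>{1..d}. coord_density (\<theta> j d) \<sigma> (fst w j) (snd w j)) \<partial>(euclid d \<Otimes>\<^sub>M euclid d)) = 1"
    unfolding euclid_def by (subst *(2)) (auto simp: one)
qed

lemma prob_space_joint_law: "prob_space (joint_law f \<theta> \<alpha> d l)"
proof
  have "emeasure (joint_law f \<theta> \<alpha> d l) (space (joint_law f \<theta> \<alpha> d l)) =
      (\<integral>\<^sup>+w. ennreal (\<Prod>j\<in>{1..d}. coord_density (\<theta> j d) \<sigma> (fst w j) (snd w j)) \<partial>(euclid d \<Otimes>\<^sub>M euclid d))"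
    unfolding joint_law_eq using measurable_joint_density
    by (subst emeasure_density) (auto intro!: nn_integral_cong)
  also have "\<dots> = 1"
    using joint_density_integral joint_density_nonneg by (subst nn_integral_eq_integral) auto
  finally show "emeasure (joint_law f \<theta> \<alpha> d l) (space (joint_law f \<theta> \<alpha> d l)) = 1" .
qed

lemma measurable_log_ratio_joint: "log_ratio \<in> borel_measurable (joint_law f \<theta> \<alpha> d l)"
  unfolding joint_law_eq by simp

lemma real_distribution_ratio_law: "real_distribution ratio_law"
proof -
  interpret prob_space "joint_law f \<theta> \<alpha> d l" by (rule prob_space_joint_law)
  show ?thesis
    unfolding ratio_law_def by (rule real_distribution_distr) (rule measurable_log_ratio_joint)
qed

text \<open>The joint density and the exponential of the sum both factor over coordinates, leaving a
  product of one-coordinate integrals.\<close>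

lemma char_ratio_law: "char ratio_law t = (\<Prod>j\<in>{1..d}. step_char t (\<theta> j d * \<sigma>))"
proof -
  let ?h = "\<lambda>j x y. coord_density (\<theta> j d) \<sigma> x y *\<^sub>R iexp (t * incr (\<theta> j d * x) (\<theta> j d * (y - x)))"
  have "char ratio_law t = (\<integral>w. iexp (t * log_ratio w) \<partial>joint_law f \<theta> \<alpha> d l)"
    unfolding ratio_law_def char_def using measurable_log_ratio_joint by (subst integral_distr) auto
  also have "\<dots> = (\<integral>w. (\<Prod>j\<in>{1..d}. coord_density (\<theta> j d) \<sigma> (fst w j) (snd w j))
      *\<^sub>R iexp (t * log_ratio w) \<partial>(euclid d \<Otimes>\<^sub>M euclid d))"
    unfolding joint_law_eq using joint_density_nonneg measurable_joint_density
    by (subst integral_density) auto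
  also have "\<dots> = (\<integral>w. (\<Prod>j\<in>{1..d}. ?h j (fst w j) (snd w j)) \<partial>(euclid d \<Otimes>\<^sub>M euclid d))"
  proof -
    have "iexp (t * log_ratio w) = (\<Prod>j\<in>{1..d}. iexp (t * incr (\<theta> j d * fst w j) (\<theta> j d * (snd w j - fst w j))))" for w
      by (simp add: log_ratio_def sum_distrib_left exp_sum)
    then show ?thesis
      by (simp only: scaleR_conv_of_real of_real_prod prod.distrib)
  qed
  also have "\<dots> = (\<Prod>j\<in>{1..d}. \<integral>x. (\<integral>y. ?h j x y \<partial>lborel) \<partial>lborel)"
    unfolding euclid_def
  proof (rule pair_PiM_integral_prod(2))
    fix j assume j: "j \<in> {1..d}"
    note cd = coord_density_integrable[OF \<theta>_pos[OF j] step_size_pos]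
    show "(\<lambda>w. ?h j (fst w) (snd w)) \<in> borel_measurable (lborel \<Otimes>\<^sub>M lborel)"
      by measurable
    show "integrable lborel (?h j x)" for x
      by (rule Bochner_Integration.integrable_bound[OF cd(1)[of x]]) auto
    show "integrable lborel (\<lambda>x. \<integral>y. norm (?h j x y) \<partial>lborel)"
      using cd coord_density_nonneg[OF \<theta>_pos[OF j]] by (simp del: of_real_mult)
  qed simp
  also have "\<dots> = (\<Prod>j\<in>{1..d}. step_char t (\<theta> j d * \<sigma>))"
    by (intro prod.cong refl step_char_coord \<theta>_pos step_size_pos)
  finally show ?thesis .
qed

text \<open>The normalising factors \<theta>_j cancel in the ratio of target densities, so only the
  law of the log ratio matters.\<close>

lemma expected_acceptance_eq:
  "expected_acceptance f \<theta> \<alpha> d l = (\<integral>r. min 1 (exp r) \<partial>ratio_law)"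
proof -
  have ratio: "target_density f \<theta> d (snd w) / target_density f \<theta> d (fst w) = exp (log_ratio w)" for w
  proof -
    have "exp (log_ratio w) = (\<Prod>j=1..d. f (\<theta> j d * snd w j) / f (\<theta> j d * fst w j))"
      unfolding log_ratio_def incr_def
      by (simp add: exp_sum exp_diff f_pos right_diff_distrib)
    also have "\<dots> = (\<Prod>j=1..d. (\<theta> j d * f (\<theta> j d * snd w j)) / (\<theta> j d * f (\<theta> j d * fst w j)))"
      using \<theta>_pos by (intro prod.cong) (auto simp: less_imp_neq[symmetric])
    finally show ?thesis
      by (simp only: target_density_def prod_dividef)
  qed
  have "expected_acceptance f \<theta> \<alpha> d l = (\<integral>w. min 1 (exp (log_ratio w)) \<partial>joint_law f \<theta> \<alpha> d l)"
    by (simp add: expected_acceptance_def split_beta' ratio)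
  also have "\<dots> = (\<integral>r. min 1 (exp r) \<partial>ratio_law)"
    unfolding ratio_law_def using measurable_log_ratio_joint by (subst integral_distr) auto
  finally show ?thesis .
qed

end

end

section \<open>The limiting acceptance rate\<close>

lemma std_normal_cdf_integral: "std_normal_cdf x = (\<integral>u. indicator {..x} u * std_normal_density u \<partial>lborel)"
proof -
  have "std_normal_cdf x = (\<integral>u. indicator {..x} u \<partial>std_normal_distribution)"
    by (simp add: cdf_def)
  also have "\<dots> = (\<integral>u. std_normal_density u *\<^sub>R indicator {..x} u \<partial>lborel)"
    by (subst integral_density) auto
  finally show ?thesis by (simp add: mult.commute)
qed

text \<open>The normal law with mean -r^2/2 and variance r^2; as an affine image of the standard
  normal it inherits its characteristic function and integrals.\<close>

definition limit_law :: "real \<Rightarrow> real measure" where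
  "limit_law r = distr std_normal_distribution borel (\<lambda>z. r * z - r\<^sup>2 / 2)"

lemma real_distribution_limit_law: "real_distribution (limit_law r)"
proof -
  interpret real_distribution std_normal_distribution by (rule real_dist_normal_dist)
  show ?thesis
    unfolding limit_law_def by (rule real_distribution_distr) auto
qed

lemma char_limit_law:
  "char (limit_law r) t = exp (of_real (- (r\<^sup>2 / 2)) * (of_real (t\<^sup>2) + \<i> * of_real t))"
proof -
  have "char (limit_law r) t = (\<integral>z. iexp (t * (r * z - r\<^sup>2 / 2)) \<partial>std_normal_distribution)"
    unfolding limit_law_def char_def by (subst integral_distr) auto
  also have "\<dots> = (\<integral>z. iexp (- (t * r\<^sup>2 / 2)) * iexp ((t * r) * z) \<partial>std_normal_distribution)"
    by (simp add: exp_add[symmetric] algebra_simps)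
  also have "\<dots> = iexp (- (t * r\<^sup>2 / 2)) * char std_normal_distribution (t * r)"
    unfolding char_def by (rule integral_mult_right_zero)
  also have "\<dots> = exp (of_real (- (r\<^sup>2 / 2)) * (of_real (t\<^sup>2) + \<i> * of_real t))"
    by (simp add: char_std_normal_distribution exp_of_real[symmetric] exp_add[symmetric]
        power_mult_distrib algebra_simps)
  finally show ?thesis .
qed

text \<open>Tilting the normal density by \<open>exp (r z - r\<^sup>2 / 2)\<close> shifts it by \<open>r\<close>; both halves of the
  minimum then contribute the same tail probability.\<close>

lemma integral_limit_law:
  assumes "0 < r"
  shows "(\<integral>x. min 1 (exp x) \<partial>limit_law r) = 2 * std_normal_cdf (- (r / 2))"
proof -
  have tilt: "std_normal_density z * exp (r * z - r\<^sup>2 / 2) = std_normal_density (z - r)" for z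
    by (simp add: std_normal_density_def exp_add[symmetric] power2_eq_square field_simps)
  have int: "integrable lborel (\<lambda>u. indicator {..x} u * std_normal_density u)" for x
    using integrable_real_mult_indicator[of "{..x}" lborel std_normal_density] by (simp add: mult.commute)
  \<comment> \<open>The exponential crosses 1 at z = r / 2; the tilted density is used to the left
    of it and the plain one to the right. The shape \<open>- r + 1 * z\<close> suits the affine
    substitution.\<close>
  have upper: "std_normal_density z * min 1 (exp (r * z - r\<^sup>2 / 2)) =
      (std_normal_density z - indicator {..r / 2} z * std_normal_density z)
      + indicator {..- (r / 2)} (- r + 1 * z) * std_normal_density (- r + 1 * z)" for z
  proof (cases "z \<le> r / 2")
    case True
    then have "r * z \<le> r * (r / 2)" using assms by (intro mult_left_mono) auto
    then have "exp (r * z - r\<^sup>2 / 2) \<le> 1" by (simp add: power2_eq_square)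
    then have "min 1 (exp (r * z - r\<^sup>2 / 2)) = exp (r * z - r\<^sup>2 / 2)" by (rule min_absorb2)
    with True show ?thesis by (simp add: tilt)
  next
    case False
    then have "r * (r / 2) < r * z" using assms by (intro mult_strict_left_mono) auto
    then have "1 \<le> exp (r * z - r\<^sup>2 / 2)" by (simp add: power2_eq_square)
    with False show ?thesis by (simp add: min_def)
  qed
  have "(\<integral>x. min 1 (exp x) \<partial>limit_law r)
      = (\<integral>z. min 1 (exp (r * z - r\<^sup>2 / 2)) \<partial>std_normal_distribution)"
    unfolding limit_law_def by (subst integral_distr) auto
  also have "\<dots> = (\<integral>z. std_normal_density z * min 1 (exp (r * z - r\<^sup>2 / 2)) \<partial>lborel)"
    by (subst integral_density) auto
  also have "\<dots> = (1 - std_normal_cdf (r / 2)) + std_normal_cdf (- (r / 2))"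
    unfolding upper
    using int lborel_integrable_real_affine[OF int, of 1 "- (r / 2)" "- r"]
      lborel_integral_real_affine[of 1 "\<lambda>u. indicator {..- (r / 2)} u * std_normal_density u" "- r"]
    by (subst Bochner_Integration.integral_add)
      (auto simp: std_normal_cdf_integral intro!: Bochner_Integration.integrable_diff)
  finally show ?thesis by (simp add: std_normal_cdf_uminus)
qed

context smooth_density begin

text \<open>The function \<open>min 1 (exp x)\<close> is bounded and continuous, so weak convergence
  of the law of the log ratio is enough. Dimensions run along a sequence because Levy's theorem
  does.\<close>

lemma expected_acceptance_tendsto:
  fixes \<theta> :: "nat \<Rightarrow> nat \<Rightarrow> real" and d :: "nat \<Rightarrow> nat"
  assumes \<theta>_pos: "\<And>k j. j \<in> {1..d k} \<Longrightarrow> 0 < \<theta> j (d k)" and "0 < l" and d_pos: "\<And>k. 0 < d k"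
    and small: "\<And>e. 0 < e \<Longrightarrow> \<forall>\<^sub>F k in sequentially. \<forall>j\<in>{1..d k}. \<theta> j (d k) * step_size \<alpha> l (d k) < e"
    and sum: "(\<lambda>k. \<Sum>j\<in>{1..d k}. (\<theta> j (d k) * step_size \<alpha> l (d k))\<^sup>2) \<longlonglongrightarrow> V"
    and "0 < V"
  shows "(\<lambda>k. expected_acceptance f \<theta> \<alpha> (d k) l) \<longlonglongrightarrow> 2 * std_normal_cdf (- (sqrt (V * fisher) / 2))"
proof -
  let ?r = "sqrt (V * fisher)"
  let ?M = "\<lambda>k. ratio_law \<theta> \<alpha> l (d k)"
  have r: "0 < ?r" "?r\<^sup>2 = V * fisher"
    using \<open>0 < V\<close> fisher_pos by simp_all
  have dist: "real_distribution (?M k)" for k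
    using \<theta>_pos \<open>0 < l\<close> d_pos by (intro real_distribution_ratio_law)
  have "weak_conv_m ?M (limit_law ?r)"
  proof (rule levy_continuity[OF dist real_distribution_limit_law])
    fix t
    have "(\<lambda>k. \<Prod>j\<in>{1..d k}. step_char t (\<theta> j (d k) * step_size \<alpha> l (d k)))
        \<longlonglongrightarrow> exp (of_real V * log_char t)"
    proof (intro prod_step_char_tendsto small sum)
      show "0 \<le> \<theta> j (d k) * step_size \<alpha> l (d k)" if "j \<in> {1..d k}" for k j
        using \<theta>_pos[OF that] by (simp add: step_size_def)
    qed
    moreover have "char (?M k) t = (\<Prod>j\<in>{1..d k}. step_char t (\<theta> j (d k) * step_size \<alpha> l (d k)))" for k
      using \<theta>_pos \<open>0 < l\<close> d_pos by (intro char_ratio_law)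
    moreover have "char (limit_law ?r) t = exp (of_real V * log_char t)"
      unfolding char_limit_law r(2) log_char_def by (simp add: mult_ac)
    ultimately show "(\<lambda>k. char (?M k) t) \<longlonglongrightarrow> char (limit_law ?r) t"
      by simp
  qed
  then have "(\<lambda>k. \<integral>x. min 1 (exp x) \<partial>?M k) \<longlonglongrightarrow> (\<integral>x. min 1 (exp x) \<partial>limit_law ?r)"
    by (intro weak_conv_imp_integral_bdd_continuous_conv[OF dist real_distribution_limit_law, where B = 1])
      (auto intro!: continuous_intros)
  moreover have "expected_acceptance f \<theta> \<alpha> (d k) l = (\<integral>x. min 1 (exp x) \<partial>?M k)" for k
    using \<theta>_pos \<open>0 < l\<close> d_pos by (intro expected_acceptance_eq)
  ultimately show ?thesis
    using integral_limit_law[OF r(1)] by simp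
qed

end

section \<open>Scaling exponents\<close>

lemma eventually_dims_at_top:
  "eventually P (dims_at_top D) \<longleftrightarrow> (\<exists>N. \<forall>d\<in>D. N \<le> d \<longrightarrow> P d)"
  unfolding dims_at_top_def eventually_inf_principal eventually_at_top_linorder by auto

text \<open>The bridge from the filter of the theorem to results about sequences.\<close>

lemma dims_at_top_eq_filtermap:
  assumes "infinite D"
  shows "dims_at_top D = filtermap (enumerate D) sequentially"
proof (rule filter_eqI)
  fix P
  show "eventually P (dims_at_top D) \<longleftrightarrow> eventually P (filtermap (enumerate D) sequentially)"
    unfolding eventually_dims_at_top eventually_filtermap eventually_sequentially
  proof safe
    fix N assume "\<forall>d\<in>D. N \<le> d \<longrightarrow> P d"
    then show "\<exists>N. \<forall>k\<ge>N. P (enumerate D k)"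
      using assms le_enumerate[OF assms] enumerate_in_set[OF assms] by (meson order_trans)
  next
    fix N assume N: "\<forall>k\<ge>N. P (enumerate D k)"
    show "\<exists>N. \<forall>d\<in>D. N \<le> d \<longrightarrow> P d"
    proof (intro exI ballI impI)
      fix d assume d: "d \<in> D" "enumerate D N \<le> d"
      then obtain k where k: "d = enumerate D k"
        using enumerate_Ex[OF assms d(1)] by metis
      with d(2) have "N \<le> k"
        using enumerate_mono_iff[OF assms, of k N] by (metis not_le)
      with N k show "P d" by simp
    qed
  qed
qed

lemma eventually_in_dims: "eventually (\<lambda>d. d \<in> D) (dims_at_top D)"
  by (auto simp: eventually_dims_at_top)

lemma dims_at_top_neq_bot: "infinite D \<Longrightarrow> dims_at_top D \<noteq> bot"
  by (simp add: dims_at_top_eq_filtermap filtermap_bot_iff)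

lemma filterlim_real_dims_at_top: "filterlim real at_top (dims_at_top D)"
  unfolding dims_at_top_def
  by (rule filterlim_mono[OF filterlim_real_sequentially order_refl inf_le1])

text \<open>A Horner step adds only a term a / x^(k+1), which vanishes at infinity and leaves the
  leading coefficient unchanged.\<close>

lemma poly_over_power_tendsto:
  fixes p :: "real poly"
  shows "((\<lambda>x. poly p x / x ^ degree p) \<longlongrightarrow> lead_coeff p) at_top"
proof (induction p)
  case 0
  then show ?case by simp
next
  case (pCons a p)
  show ?case
  proof (cases "p = 0")
    case True
    then show ?thesis by simp
  next
    case False
    have "((\<lambda>x::real. a / x ^ Suc (degree p) + poly p x / x ^ degree p) \<longlongrightarrow> 0 + lead_coeff p) at_top"
      by (intro tendsto_add pCons.IH real_tendsto_divide_at_top[OF tendsto_const]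
          filterlim_pow_at_top filterlim_ident) simp
    moreover have "\<forall>\<^sub>F x in at_top. a / x ^ Suc (degree p) + poly p x / x ^ degree p
        = poly (pCons a p) x / x ^ degree (pCons a p)"
      using eventually_gt_at_top[of 0]
      by eventually_elim (use False in \<open>simp add: field_simps\<close>)
    ultimately show ?thesis
      using False by (simp add: tendsto_cong)
  qed
qed

lemma powr_ratio_tendsto:
  fixes x \<alpha> :: real
  shows "x < \<alpha> \<Longrightarrow> ((\<lambda>d. real d powr x / real d powr \<alpha>) \<longlongrightarrow> 0) (dims_at_top D)"
    and "((\<lambda>d. real d powr x / real d powr x) \<longlongrightarrow> 1) (dims_at_top D)"
    and "\<alpha> < x \<Longrightarrow> filterlim (\<lambda>d. real d powr x / real d powr \<alpha>) at_top (dims_at_top D)"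
proof -
  note lim = filterlim_real_dims_at_top[of D]
  have eq: "real d powr x / real d powr \<alpha> = real d powr (x - \<alpha>)" for d
    by (simp add: powr_diff)
  show "((\<lambda>d. real d powr x / real d powr \<alpha>) \<longlongrightarrow> 0) (dims_at_top D)" if "x < \<alpha>"
    unfolding eq by (rule tendsto_neg_powr[OF _ lim]) (use that in simp)
  show "filterlim (\<lambda>d. real d powr x / real d powr \<alpha>) at_top (dims_at_top D)" if "\<alpha> < x"
    unfolding eq
    using that by (intro filterlim_compose[OF _ lim]) real_asymp
  have "\<forall>\<^sub>F d in dims_at_top D. 0 < real d"
    using lim by (simp only: filterlim_at_top_dense)
  then have "\<forall>\<^sub>F d in dims_at_top D. 1 = real d powr x / real d powr x"
    by eventually_elim simp
  then show "((\<lambda>d. real d powr x / real d powr x) \<longlongrightarrow> 1) (dims_at_top D)"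
    by (rule tendsto_eventually[OF eventually_mono]) simp
qed

section \<open>Growth of the groups and the value of the exponent\<close>

locale scaled_groups =
  fixes n m :: nat and K lam gam :: "nat \<Rightarrow> real" and \<theta> :: "nat \<Rightarrow> nat \<Rightarrow> real"
    and J :: "nat \<Rightarrow> nat \<Rightarrow> nat set" and D :: "nat set"
  assumes m_pos: "1 \<le> m"
    and K_pos: "\<And>j. j \<in> {1..n + m} \<Longrightarrow> K j > 0"
    and lam_decreasing: "antimono_on {1..n} lam"
    and D_infinite: "infinite D"
    and J_disjoint: "\<And>d. d \<in> D \<Longrightarrow> disjoint_family_on (\<lambda>i. J i d) {1..m}"
    and J_union: "\<And>d. d \<in> D \<Longrightarrow> (\<Union>i\<in>{1..m}. J i d) = {n + 1..d}"
    and J_mem: "\<And>d i. d \<in> D \<Longrightarrow> i \<in> {1..m} \<Longrightarrow> n + i \<in> J i d"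
    and J_poly: "\<And>i. i \<in> {1..m} \<Longrightarrow>
        \<exists>p :: real poly. \<forall>d\<in>D. real (card (J i d)) = poly p (real d)"
    and J_infinity: "\<And>i. i \<in> {1..m} \<Longrightarrow>
        filterlim (\<lambda>d. card (J i d)) at_top (dims_at_top D)"
    and \<theta>_pos: "\<And>d j. d \<in> D \<Longrightarrow> j \<in> {1..d} \<Longrightarrow> \<theta> j d > 0"
    and \<theta>_single: "\<And>d j. d \<in> D \<Longrightarrow> j \<in> {1..n} \<Longrightarrow>
        1 / (\<theta> j d)\<^sup>2 = K j / real d powr lam j"
    and \<theta>_group: "\<And>d i j. d \<in> D \<Longrightarrow> i \<in> {1..m} \<Longrightarrow> j \<in> J i d \<Longrightarrow>
        1 / (\<theta> j d)\<^sup>2 = K (n + i) / real d powr gam i"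
    and lam1_negligible: "1 \<le> n \<Longrightarrow>
        ((\<lambda>d. real d powr lam 1 /
            ((\<Sum>j=1..n. real d powr lam j) + (\<Sum>i=1..m. real (card (J i d)) * real d powr gam i)))
          \<longlongrightarrow> 0) (dims_at_top D)"
begin

abbreviation DF :: "nat filter" where "DF \<equiv> dims_at_top D"

lemma DF_neq_bot [simp]: "DF \<noteq> bot"
  using D_infinite by (rule dims_at_top_neq_bot)

text \<open>Index n + 1 belongs to the first group, which lies inside {n + 1..d}. In particular no
  dimension in \<open>D\<close> is 0, so division by powers of d is safe.\<close>

lemma dims_gt:
  assumes "d \<in> D"
  shows "n < d"
  using J_mem[OF assms, of 1] J_union[OF assms] m_pos by force

text \<open>The exponent is the degree of the polynomial. Its leading coefficient is nonnegative as
  a limit of nonnegative ratios, and 0 would mean the zero polynomial, against unbounded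
  cardinalities.\<close>

lemma card_asymptotics:
  assumes i: "i \<in> {1..m}"
  obtains k a where "0 < a" "((\<lambda>d. real (card (J i d)) / real d powr k) \<longlongrightarrow> a) DF"
proof -
  obtain p :: "real poly" where p: "\<And>d. d \<in> D \<Longrightarrow> real (card (J i d)) = poly p (real d)"
    using J_poly[OF i] by blast
  have "((\<lambda>d. poly p (real d) / real d ^ degree p) \<longlongrightarrow> lead_coeff p) DF"
    by (rule filterlim_compose[OF poly_over_power_tendsto filterlim_real_dims_at_top])
  moreover have "\<forall>\<^sub>F d in DF. poly p (real d) / real d ^ degree p = real (card (J i d)) / real d powr real (degree p)"
    using eventually_in_dims
  proof eventually_elim
    case (elim d)
    then have "0 < real d" using dims_gt[of d] by simp
    then show ?case using p[OF elim] by (simp add: powr_realpow)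
  qed
  ultimately have lim: "((\<lambda>d. real (card (J i d)) / real d powr real (degree p)) \<longlongrightarrow> lead_coeff p) DF"
    by (rule Lim_transform_eventually)
  have "0 \<le> lead_coeff p"
    by (rule tendsto_lowerbound[OF lim]) auto
  moreover have "lead_coeff p \<noteq> 0"
  proof
    assume "lead_coeff p = 0"
    then have "\<forall>\<^sub>F d in DF. card (J i d) = 0"
      using p by (intro eventually_mono[OF eventually_in_dims]) force
    moreover have "\<forall>\<^sub>F d in DF. 0 < card (J i d)"
      using J_infinity[OF i] eventually_gt_at_top[of 0] by (rule filterlim_iff[THEN iffD1, rule_format])
    ultimately have "\<forall>\<^sub>F d in DF. False"
      by eventually_elim simp
    then show False by simp
  qed
  ultimately have "0 < lead_coeff p"
    by (rule order_le_neq_trans[OF _ not_sym])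
  then show ?thesis
    using lim by (rule that)
qed

text \<open>Strict positivity of the constants is what makes each exponent sharp: any smaller one
  leads to divergence.\<close>

lemma growth_exponents:
  "\<exists>e a. \<forall>i\<in>{1..m}. 0 < a i \<and>
    ((\<lambda>d. real d powr gam i * real (card (J i d)) / real d powr e i) \<longlongrightarrow> a i) DF"
proof -
  have "\<exists>k a. 0 < a \<and> ((\<lambda>d. real (card (J i d)) / real d powr k) \<longlongrightarrow> a) DF" if "i \<in> {1..m}" for i
    using card_asymptotics[OF that] by metis
  then obtain k a where ka: "\<And>i. i \<in> {1..m} \<Longrightarrow>
      0 < a i \<and> ((\<lambda>d. real (card (J i d)) / real d powr k i) \<longlongrightarrow> a i) DF"
    by metis
  have "((\<lambda>d. real d powr gam i * real (card (J i d)) / real d powr (gam i + k i)) \<longlongrightarrow> a i) DF"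
    if "i \<in> {1..m}" for i
  proof (rule Lim_transform_eventually)
    show "((\<lambda>d. real (card (J i d)) / real d powr k i) \<longlongrightarrow> a i) DF"
      using ka[OF that] by simp
    show "\<forall>\<^sub>F d in DF. real (card (J i d)) / real d powr k i =
        real d powr gam i * real (card (J i d)) / real d powr (gam i + k i)"
      using eventually_in_dims
    proof eventually_elim
      case (elim d)
      then have "0 < real d" using dims_gt[of d] by simp
      then show ?case by (simp add: powr_add)
    qed
  qed
  with ka show ?thesis
    by (intro exI[of _ "\<lambda>i. gam i + k i"] exI[of _ a]) auto
qed


lemma ratio_factor:
  "\<forall>\<^sub>F d in DF. real d powr gam i * real (card (J i d)) / real d powr e * (real d powr e / real d powr \<alpha>)
    = real d powr gam i * real (card (J i d)) / real d powr \<alpha>"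
  using eventually_in_dims
proof eventually_elim
  case (elim d)
  then have "0 < real d" using dims_gt[of d] by simp
  then show ?case by simp
qed

lemma growth_limit:
  assumes e: "((\<lambda>d. real d powr gam i * real (card (J i d)) / real d powr e) \<longlongrightarrow> a) DF" and "e \<le> \<alpha>"
  shows "((\<lambda>d. real d powr gam i * real (card (J i d)) / real d powr \<alpha>)
    \<longlongrightarrow> (if e = \<alpha> then a else 0)) DF"
proof (cases "e = \<alpha>")
  case True
  with e show ?thesis by simp
next
  case False
  then have "((\<lambda>d. real d powr gam i * real (card (J i d)) / real d powr e * (real d powr e / real d powr \<alpha>))
      \<longlongrightarrow> a * 0) DF"
    using \<open>e \<le> \<alpha>\<close> by (intro tendsto_mult e powr_ratio_tendsto) auto
  then have "((\<lambda>d. real d powr gam i * real (card (J i d)) / real d powr \<alpha>) \<longlongrightarrow> a * 0) DF"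
    by (rule Lim_transform_eventually[OF _ ratio_factor])
  with False show ?thesis by simp
qed

lemma growth_unbounded:
  assumes e: "((\<lambda>d. real d powr gam i * real (card (J i d)) / real d powr e) \<longlongrightarrow> a) DF" and "0 < a" "\<alpha> < e"
  shows "\<not> ((\<lambda>d. real d powr gam i * real (card (J i d)) / real d powr \<alpha>) \<longlongrightarrow> L) DF"
proof -
  have "filterlim (\<lambda>d. real d powr gam i * real (card (J i d)) / real d powr e * (real d powr e / real d powr \<alpha>))
      at_top DF"
    by (rule filterlim_tendsto_pos_mult_at_top[OF e \<open>0 < a\<close> powr_ratio_tendsto(3)[OF \<open>\<alpha> < e\<close>]])
  then have "filterlim (\<lambda>d. real d powr gam i * real (card (J i d)) / real d powr \<alpha>) at_top DF"
    by (rule filterlim_cong[OF refl refl ratio_factor, THEN iffD1])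
  then show ?thesis
    using not_tendsto_and_filterlim_at_infinity[OF DF_neq_bot] filterlim_at_top_imp_at_infinity by blast
qed

text \<open>The admissible exponents are the upper bounds of a finite set \<open>A\<close> of growth
  exponents, so the least one is its maximum. Negligibility of \<open>lam 1\<close> excludes it as a
  maximiser; the maximum then comes from a group, whose limit is positive.\<close>

lemma scaling_limits:
  defines "\<alpha> \<equiv> scaling_exponent D n m lam gam J"
  shows "1 \<le> n \<Longrightarrow> lam 1 < \<alpha>"
    and "\<exists>L. (\<exists>i\<in>{1..m}. 0 < L i) \<and> (\<forall>i\<in>{1..m}. 0 \<le> L i \<and>
      ((\<lambda>d. real d powr gam i * real (card (J i d)) / real d powr \<alpha>) \<longlongrightarrow> L i) DF)"
proof -
  obtain e a where "\<forall>i\<in>{1..m}. 0 < a i \<and>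
    ((\<lambda>d. real d powr gam i * real (card (J i d)) / real d powr e i) \<longlongrightarrow> a i) DF"
    using growth_exponents by (elim exE)
  then have ea: "\<And>i. i \<in> {1..m} \<Longrightarrow> 0 < a i"
    "\<And>i. i \<in> {1..m} \<Longrightarrow> ((\<lambda>d. real d powr gam i * real (card (J i d)) / real d powr e i) \<longlongrightarrow> a i) DF"
    by auto
  define A where "A = e ` {1..m} \<union> (if 1 \<le> n then {lam 1} else {})"
  have A: "finite A" "A \<noteq> {}"
    using m_pos by (auto simp: A_def)
  have admissible_iff: "scaling_admissible D n m lam gam J \<beta> \<longleftrightarrow> (\<forall>x\<in>A. x \<le> \<beta>)" for \<beta>
  proof
    assume adm: "scaling_admissible D n m lam gam J \<beta>"
    have "e i \<le> \<beta>" if "i \<in> {1..m}" for i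
      using adm growth_unbounded[OF ea(2)[OF that] ea(1)[OF that], of \<beta>] that
      unfolding scaling_admissible_def by (metis not_le)
    moreover have "lam 1 \<le> \<beta>" if "1 \<le> n"
      using adm that powr_ratio_tendsto(3)[of \<beta> "lam 1" D] not_tendsto_and_filterlim_at_infinity[OF DF_neq_bot]
        filterlim_at_top_imp_at_infinity
      unfolding scaling_admissible_def by (metis not_le)
    ultimately show "\<forall>x\<in>A. x \<le> \<beta>"
      by (auto simp: A_def split: if_splits)
  next
    assume le: "\<forall>x\<in>A. x \<le> \<beta>"
    have "\<exists>L. ((\<lambda>d. real d powr gam i * real (card (J i d)) / real d powr \<beta>) \<longlongrightarrow> L) DF"
      if "i \<in> {1..m}" for i
      using growth_limit[OF ea(2)[OF that], of \<beta>] le that by (auto simp: A_def)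
    moreover have "\<exists>L. ((\<lambda>d. real d powr lam 1 / real d powr \<beta>) \<longlongrightarrow> L) DF" if "1 \<le> n"
    proof (cases "lam 1 = \<beta>")
      case True
      then show ?thesis using powr_ratio_tendsto(2) by blast
    next
      case False
      then have "lam 1 < \<beta>" using le that by (auto simp: A_def)
      then show ?thesis using powr_ratio_tendsto(1) by blast
    qed
    ultimately show "scaling_admissible D n m lam gam J \<beta>"
      unfolding scaling_admissible_def by blast
  qed
  have \<alpha>_eq: "\<alpha> = Max A"
    unfolding \<alpha>_def scaling_exponent_def admissible_iff
    using A by (intro Least_equality) auto
  define L where "L i = (if e i = \<alpha> then a i else 0)" for i
  have L: "((\<lambda>d. real d powr gam i * real (card (J i d)) / real d powr \<alpha>) \<longlongrightarrow> L i) DF" if "i \<in> {1..m}" for i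
    unfolding L_def using that A by (intro growth_limit ea(2)) (auto simp: \<alpha>_eq A_def)
  have L_nonneg: "0 \<le> L i" if "i \<in> {1..m}" for i
    using ea(1)[OF that] by (simp add: L_def)
  show lam1: "lam 1 < \<alpha>" if n: "1 \<le> n"
  proof (rule ccontr)
    \<comment> \<open>Otherwise the ratio in \<open>lam1_negligible\<close> stays bounded away from zero.\<close>
    assume "\<not> lam 1 < \<alpha>"
    moreover have "lam 1 \<le> \<alpha>"
      using n A by (auto simp: \<alpha>_eq A_def)
    ultimately have eq: "lam 1 = \<alpha>" by simp
    \<comment> \<open>Bounds the denominator divided by d^\<alpha>: each single term contributes at
      most 1, and group i eventually less than \<open>L i + 1\<close>.\<close>
    define B where "B = real n + (\<Sum>i=1..m. L i + 1)"
    have "0 \<le> (\<Sum>i=1..m. L i + 1)"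
      by (intro sum_nonneg add_nonneg_nonneg L_nonneg) auto
    then have "0 < B"
      using n by (simp add: B_def)
    have "\<forall>\<^sub>F d in DF. \<forall>i\<in>{1..m}. real d powr gam i * real (card (J i d)) / real d powr \<alpha> < L i + 1"
      by (intro eventually_ball_finite ballI order_tendstoD(2)[OF L]) auto
    then have "\<forall>\<^sub>F d in DF. 1 / B \<le> real d powr lam 1 /
      ((\<Sum>j=1..n. real d powr lam j) + (\<Sum>i=1..m. real (card (J i d)) * real d powr gam i))"
      using eventually_in_dims
    proof eventually_elim
      case (elim d)
      then have d: "1 \<le> real d" using dims_gt[of d] by simp
      let ?den = "(\<Sum>j=1..n. real d powr lam j) + (\<Sum>i=1..m. real (card (J i d)) * real d powr gam i)"
      have "(\<Sum>j=1..n. real d powr lam j) \<le> (\<Sum>j=1..n. real d powr \<alpha>)"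
      proof (intro sum_mono powr_mono d)
        fix j assume "j \<in> {1..n}"
        then show "lam j \<le> \<alpha>"
          using lam_decreasing n by (auto simp: monotone_on_def eq[symmetric])
      qed
      moreover have "(\<Sum>i=1..m. real (card (J i d)) * real d powr gam i) \<le> (\<Sum>i=1..m. (L i + 1) * real d powr \<alpha>)"
      proof (intro sum_mono)
        fix i assume "i \<in> {1..m}"
        with elim have "real d powr gam i * real (card (J i d)) / real d powr \<alpha> < L i + 1" by blast
        then show "real (card (J i d)) * real d powr gam i \<le> (L i + 1) * real d powr \<alpha>"
          using d by (simp add: pos_divide_less_eq mult.commute)
      qed
      ultimately have "?den \<le> B * real d powr \<alpha>"
        by (simp add: B_def sum_distrib_right distrib_right)
      moreover have "0 < ?den"
        using n d by (intro add_pos_nonneg sum_pos sum_nonneg) auto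
      ultimately show ?case
        using d \<open>0 < B\<close> unfolding eq by (simp add: field_simps)
    qed
    then have "1 / B \<le> 0"
      by (rule tendsto_lowerbound[OF lam1_negligible[OF n] _ DF_neq_bot])
    with \<open>0 < B\<close> show False by simp
  qed
  \<comment> \<open>The maximum is attained in \<open>A\<close> but not by \<open>lam 1\<close>, so
    it is the growth exponent of some group.\<close>
  have "\<alpha> \<in> A" unfolding \<alpha>_eq using A by (rule Max_in)
  with lam1 obtain i where "i \<in> {1..m}" "e i = \<alpha>"
    by (auto simp: A_def split: if_splits)
  then have "\<exists>i\<in>{1..m}. 0 < L i"
    using ea(1) by (auto simp: L_def)
  with L_nonneg L show "\<exists>L. (\<exists>i\<in>{1..m}. 0 < L i) \<and> (\<forall>i\<in>{1..m}. 0 \<le> L i \<and>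
      ((\<lambda>d. real d powr gam i * real (card (J i d)) / real d powr \<alpha>) \<longlongrightarrow> L i) DF)"
    by (intro exI[of _ L] conjI ballI)
qed

section \<open>Sizes of the individual steps\<close>

lemma theta_sq_single: "d \<in> D \<Longrightarrow> j \<in> {1..n} \<Longrightarrow> (\<theta> j d)\<^sup>2 = real d powr lam j / K j"
  using \<theta>_single[of d j] by (metis inverse_divide inverse_inverse_eq inverse_eq_divide)

lemma theta_sq_group: "d \<in> D \<Longrightarrow> i \<in> {1..m} \<Longrightarrow> j \<in> J i d \<Longrightarrow> (\<theta> j d)\<^sup>2 = real d powr gam i / K (n + i)"
  using \<theta>_group[of d i j] by (metis inverse_divide inverse_inverse_eq inverse_eq_divide)

lemma index_split:
  assumes "d \<in> D"
  shows "{1..d} = {1..n} \<union> (\<Union>i\<in>{1..m}. J i d)" "{1..n} \<inter> (\<Union>i\<in>{1..m}. J i d) = {}"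
    "\<And>i. i \<in> {1..m} \<Longrightarrow> finite (J i d)"
proof -
  show "{1..d} = {1..n} \<union> (\<Union>i\<in>{1..m}. J i d)" "{1..n} \<inter> (\<Union>i\<in>{1..m}. J i d) = {}"
    unfolding J_union[OF assms] using dims_gt[OF assms] by auto
  show "finite (J i d)" if "i \<in> {1..m}" for i
    using J_union[OF assms] that by (intro finite_subset[of "J i d" "{n + 1..d}"]) auto
qed

lemma sum_index_split:
  fixes h :: "nat \<Rightarrow> real"
  assumes d: "d \<in> D"
  shows "(\<Sum>j\<in>{1..d}. h j) = (\<Sum>j=1..n. h j) + (\<Sum>i=1..m. \<Sum>j\<in>J i d. h j)"
proof -
  have "(\<Sum>j\<in>(\<Union>i\<in>{1..m}. J i d). h j) = (\<Sum>i=1..m. \<Sum>j\<in>J i d. h j)"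
    using index_split(3)[OF d] J_disjoint[OF d]
    by (intro sum.UNION_disjoint) (auto simp: disjoint_family_on_def)
  then show ?thesis
    unfolding index_split(1)[OF d] using index_split(2,3)[OF d] by (subst sum.union_disjoint) auto
qed


lemma K_group_nonzero: "i \<in> {1..m} \<Longrightarrow> K (n + i) \<noteq> 0"
  using K_pos[of "n + i"] by simp

context
  fixes \<alpha> l :: real and L :: "nat \<Rightarrow> real"
  assumes L: "\<And>i. i \<in> {1..m} \<Longrightarrow>
      ((\<lambda>d. real d powr gam i * real (card (J i d)) / real d powr \<alpha>) \<longlongrightarrow> L i) DF"
    and lam1: "1 \<le> n \<Longrightarrow> lam 1 < \<alpha>"
    and l_pos: "0 < l"
begin

lemma single_step_tendsto:
  assumes j: "j \<in> {1..n}"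
  shows "((\<lambda>d. (\<theta> j d * step_size \<alpha> l d)\<^sup>2) \<longlongrightarrow> 0) DF"
proof -
  have "lam j \<le> lam 1"
    using lam_decreasing j by (auto simp: monotone_on_def)
  then have "lam j < \<alpha>"
    using lam1 j by auto
  then have "((\<lambda>d. l\<^sup>2 / K j * (real d powr lam j / real d powr \<alpha>)) \<longlongrightarrow> l\<^sup>2 / K j * 0) DF"
    by (intro tendsto_mult_left powr_ratio_tendsto(1))
  moreover have "\<forall>\<^sub>F d in DF. l\<^sup>2 / K j * (real d powr lam j / real d powr \<alpha>) = (\<theta> j d * step_size \<alpha> l d)\<^sup>2"
    using eventually_in_dims
    by eventually_elim (use j in \<open>simp add: power_mult_distrib theta_sq_single step_size_def\<close>)
  ultimately show ?thesis
    by (simp add: tendsto_cong)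
qed

text \<open>The combined squared steps of a group converge, up to constants, and are shared equally
  among a number of members tending to infinity.\<close>

lemma group_step_tendsto:
  assumes i: "i \<in> {1..m}"
  shows "((\<lambda>d. l\<^sup>2 / K (n + i) * (real d powr gam i / real d powr \<alpha>)) \<longlongrightarrow> 0) DF"
proof -
  have "filterlim (\<lambda>d. real (card (J i d))) at_top DF"
    using filterlim_compose[OF filterlim_real_sequentially J_infinity[OF i]] .
  then have "((\<lambda>d. real d powr gam i * real (card (J i d)) / real d powr \<alpha> / real (card (J i d))) \<longlongrightarrow> 0) DF"
    by (rule real_tendsto_divide_at_top[OF L[OF i]])
  moreover have "\<forall>\<^sub>F d in DF. real d powr gam i * real (card (J i d)) / real d powr \<alpha> / real (card (J i d))
      = real d powr gam i / real d powr \<alpha>"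
    using filterlim_iff[THEN iffD1, rule_format, OF J_infinity[OF i] eventually_gt_at_top[of 0]]
    by eventually_elim simp
  ultimately have "((\<lambda>d. real d powr gam i / real d powr \<alpha>) \<longlongrightarrow> 0) DF"
    by (rule Lim_transform_eventually)
  then show ?thesis
    by (rule tendsto_mult_right_zero)
qed

lemma group_step_eq:
  assumes "d \<in> D" "i \<in> {1..m}" "j \<in> J i d"
  shows "(\<theta> j d * step_size \<alpha> l d)\<^sup>2 = l\<^sup>2 / K (n + i) * (real d powr gam i / real d powr \<alpha>)"
  using assms by (simp add: power_mult_distrib theta_sq_group[OF assms] step_size_def)

text \<open>Steps are equal within a group, so uniformity over d indices reduces to the fixed number
  n + m of limits.\<close>

lemma steps_small:
  assumes "0 < e"
  shows "\<forall>\<^sub>F d in DF. \<forall>j\<in>{1..d}. \<theta> j d * step_size \<alpha> l d < e"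
proof -
  have "0 < e\<^sup>2" using assms by simp
  then have "\<forall>\<^sub>F d in DF. \<forall>j\<in>{1..n}. (\<theta> j d * step_size \<alpha> l d)\<^sup>2 < e\<^sup>2"
    "\<forall>\<^sub>F d in DF. \<forall>i\<in>{1..m}. l\<^sup>2 / K (n + i) * (real d powr gam i / real d powr \<alpha>) < e\<^sup>2"
    by (intro eventually_ball_finite ballI order_tendstoD(2)[OF single_step_tendsto]
        order_tendstoD(2)[OF group_step_tendsto]; simp)+
  then show ?thesis
    using eventually_in_dims
  proof eventually_elim
    case (elim d)
    show ?case
    proof
      fix j assume "j \<in> {1..d}"
      then have "j \<in> {1..n} \<or> (\<exists>i\<in>{1..m}. j \<in> J i d)"
        using index_split(1)[OF elim(3)] by blast
      then have "(\<theta> j d * step_size \<alpha> l d)\<^sup>2 < e\<^sup>2"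
        using elim group_step_eq by metis
      then show "\<theta> j d * step_size \<alpha> l d < e"
        using assms by (simp add: power_less_imp_less_base)
    qed
  qed
qed

text \<open>The single coordinates are fixed in number and vanish one by one; equal steps turn each
  group sum into cardinality times one squared step.\<close>

lemma steps_sum_tendsto:
  "((\<lambda>d. \<Sum>j\<in>{1..d}. (\<theta> j d * step_size \<alpha> l d)\<^sup>2) \<longlongrightarrow> l\<^sup>2 * (\<Sum>i=1..m. L i / K (n + i))) DF"
proof -
  have "((\<lambda>d. (\<Sum>j=1..n. (\<theta> j d * step_size \<alpha> l d)\<^sup>2)
      + l\<^sup>2 * (\<Sum>i=1..m. real d powr gam i * real (card (J i d)) / real d powr \<alpha> / K (n + i)))
    \<longlongrightarrow> (\<Sum>j=1..n. 0) + l\<^sup>2 * (\<Sum>i=1..m. L i / K (n + i))) DF"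
    by (intro tendsto_add tendsto_sum tendsto_mult_left tendsto_divide tendsto_const single_step_tendsto
        L K_group_nonzero)
  moreover have "\<forall>\<^sub>F d in DF. (\<Sum>j=1..n. (\<theta> j d * step_size \<alpha> l d)\<^sup>2)
      + l\<^sup>2 * (\<Sum>i=1..m. real d powr gam i * real (card (J i d)) / real d powr \<alpha> / K (n + i))
      = (\<Sum>j\<in>{1..d}. (\<theta> j d * step_size \<alpha> l d)\<^sup>2)"
    using eventually_in_dims
  proof eventually_elim
    case (elim d)
    have "(\<Sum>j\<in>J i d. (\<theta> j d * step_size \<alpha> l d)\<^sup>2)
        = l\<^sup>2 * (real d powr gam i * real (card (J i d)) / real d powr \<alpha> / K (n + i))" if "i \<in> {1..m}" for i
      using group_step_eq[OF elim that] by (simp add: mult_ac)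
    then show ?case
      unfolding sum_index_split[OF elim] by (simp add: sum_distrib_left)
  qed
  ultimately show ?thesis
    by (simp add: tendsto_cong)
qed

end

end


section \<open>Assembly\<close>

lemma smooth_density_exists:
  fixes f f' f'' :: "real \<Rightarrow> real"
  assumes f_pos: "\<And>x. f x > 0"
    and f_prob: "prob_space (density lborel (\<lambda>x. ennreal (f x)))"
    and f_deriv: "\<And>x. (f has_real_derivative f' x) (at x)"
    and f'_deriv: "\<And>x. (f' has_real_derivative f'' x) (at x)"
    and f''_cont: "continuous_on UNIV f''"
    and log_lipschitz: "\<exists>C. C-lipschitz_on UNIV (deriv (\<lambda>x. ln (f x)))"
    and moment4: "integrable (density lborel (\<lambda>x. ennreal (f x))) (\<lambda>x. (f' x / f x) ^ 4)"
    and moment2: "integrable (density lborel (\<lambda>x. ennreal (f x))) (\<lambda>x. (f'' x / f x) ^ 2)"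
  shows "\<exists>C. smooth_density f f' f'' C"
proof -
  obtain C where "C-lipschitz_on UNIV (deriv (\<lambda>x. ln (f x)))"
    using log_lipschitz by blast
  moreover have "deriv (\<lambda>x. ln (f x)) = (\<lambda>x. f' x / f x)"
    using f_pos f_deriv
    by (intro ext DERIV_imp_deriv) (auto intro!: derivative_eq_intros simp: field_simps)
  ultimately have lipschitz: "C-lipschitz_on UNIV (\<lambda>x. f' x / f x)"
    by simp
  have f'_meas: "(\<lambda>x. f' x / f x) \<in> borel_measurable borel"
    using f_deriv f'_deriv f_pos
    by (intro borel_measurable_continuous_onI continuous_on_divide DERIV_continuous_on)
      (auto intro: has_field_derivative_at_within simp: less_imp_neq[symmetric])
  interpret f_law: prob_space "density lborel (\<lambda>x. ennreal (f x))"
    by (rule f_prob)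
  \<comment> \<open>The squared score is square integrable by the fourth moment, hence integrable on
    a probability space.\<close>
  have score_sq: "integrable (density lborel (\<lambda>x. ennreal (f x))) (\<lambda>x. (f' x / f x)\<^sup>2)"
  proof (rule f_law.square_integrable_imp_integrable)
    show "(\<lambda>x. (f' x / f x)\<^sup>2) \<in> borel_measurable (density lborel (\<lambda>x. ennreal (f x)))"
      using f'_meas by simp
    show "integrable (density lborel (\<lambda>x. ennreal (f x))) (\<lambda>x. ((f' x / f x)\<^sup>2)\<^sup>2)"
      using moment4 by (simp flip: power_mult)
  qed
  show ?thesis
  proof (intro exI smooth_density.intro)
    show "C-lipschitz_on UNIV (\<lambda>x. f' x / f x)" by (rule lipschitz)
    show "integrable (density lborel (\<lambda>x. ennreal (f x))) (\<lambda>x. (f' x / f x)\<^sup>2)" by (rule score_sq)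
  qed (rule f_pos f_prob f_deriv f'_deriv f''_cont moment2)+
qed

theorem corollary2:
  fixes f f' f'' :: "real \<Rightarrow> real"
    and n m istar :: nat
    and K lam gam :: "nat \<Rightarrow> real"
    and \<theta> :: "nat \<Rightarrow> nat \<Rightarrow> real"
    and J :: "nat \<Rightarrow> nat \<Rightarrow> nat set"
    and D :: "nat set"
    and \<alpha> E\<^sub>R :: real
    and G :: "nat \<Rightarrow> real"
  assumes f_pos: "\<And>x. f x > 0"
    and f_prob: "prob_space (density lborel (\<lambda>x. ennreal (f x)))"
    and f_deriv: "\<And>x. (f has_real_derivative f' x) (at x)"
    and f'_deriv: "\<And>x. (f' has_real_derivative f'' x) (at x)"
    and f''_cont: "continuous_on UNIV f''"
    and log_lipschitz: "\<exists>C. C-lipschitz_on UNIV (deriv (\<lambda>x. ln (f x)))"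
    and moment4: "integrable (density lborel (\<lambda>x. ennreal (f x))) (\<lambda>x. (f' x / f x) ^ 4)"
    and moment2: "integrable (density lborel (\<lambda>x. ennreal (f x))) (\<lambda>x. (f'' x / f x) ^ 2)"
    and m_pos: "1 \<le> m"
    and K_pos: "\<And>j. j \<in> {1..n + m} \<Longrightarrow> K j > 0"
    and lam_decreasing: "antimono_on {1..n} lam"
    and gam_decreasing: "antimono_on {1..m} gam"
    and D_infinite: "infinite D"
    and J_disjoint: "\<And>d. d \<in> D \<Longrightarrow> disjoint_family_on (\<lambda>i. J i d) {1..m}"
    and J_union: "\<And>d. d \<in> D \<Longrightarrow> (\<Union>i\<in>{1..m}. J i d) = {n + 1..d}"
    and J_mem: "\<And>d i. d \<in> D \<Longrightarrow> i \<in> {1..m} \<Longrightarrow> n + i \<in> J i d"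
    and J_poly: "\<And>i. i \<in> {1..m} \<Longrightarrow>
        \<exists>p :: real poly. \<forall>d\<in>D. real (card (J i d)) = poly p (real d)"
    and J_infinity: "\<And>i. i \<in> {1..m} \<Longrightarrow>
        filterlim (\<lambda>d. card (J i d)) at_top (dims_at_top D)"
    and \<theta>_pos: "\<And>d j. d \<in> D \<Longrightarrow> j \<in> {1..d} \<Longrightarrow> \<theta> j d > 0"
    and \<theta>_single: "\<And>d j. d \<in> D \<Longrightarrow> j \<in> {1..n} \<Longrightarrow>
        1 / (\<theta> j d)\<^sup>2 = K j / real d powr lam j"
    and \<theta>_group: "\<And>d i j. d \<in> D \<Longrightarrow> i \<in> {1..m} \<Longrightarrow> j \<in> J i d \<Longrightarrow>
        1 / (\<theta> j d)\<^sup>2 = K (n + i) / real d powr gam i"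
    and istar_range: "istar \<in> {1..n + m}"
    and \<theta>_istar: "\<And>d. d \<in> D \<Longrightarrow> \<theta> istar d = 1"
    and alpha: "\<alpha> = scaling_exponent D n m lam gam J"
    and lam1_negligible: "1 \<le> n \<Longrightarrow>
        ((\<lambda>d. real d powr lam 1 /
            ((\<Sum>j=1..n. real d powr lam j) + (\<Sum>i=1..m. real (card (J i d)) * real d powr gam i)))
          \<longlongrightarrow> 0) (dims_at_top D)"
    and G: "G = (\<lambda>d. \<Sum>i=1..m. real (card (J i d)) / real d powr \<alpha> * (real d powr gam i / K (n + i))
              * (\<integral>x. (f' x / f x)\<^sup>2 \<partial>density lborel (\<lambda>x. ennreal (f x))))"
    and E\<^sub>R: "E\<^sub>R = Lim (dims_at_top D) G"
  shows "(G \<longlongrightarrow> E\<^sub>R) (dims_at_top D) \<and>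
    (\<forall>l>0. ((\<lambda>d. expected_acceptance f \<theta> \<alpha> d l) \<longlongrightarrow> asymptotic_acceptance E\<^sub>R l)
       (dims_at_top D)) \<and>
    (\<exists>lhat c. (\<forall>l. is_arg_max (speed E\<^sub>R) (\<lambda>l. 0 < l) l \<longleftrightarrow> l = lhat) \<and>
       lhat = c / sqrt E\<^sub>R \<and> \<bar>c - 2.38\<bar> < 0.005 \<and>
       \<bar>asymptotic_acceptance E\<^sub>R lhat - 0.234\<bar> < 0.0005)"
proof -
  have "\<exists>C. smooth_density f f' f'' C"
    by (rule smooth_density_exists) (rule f_pos f_prob f_deriv f'_deriv f''_cont log_lipschitz moment4 moment2)+
  then obtain C where C: "smooth_density f f' f'' C"
    by (elim exE)
  interpret smooth_density f f' f'' C
    by (rule C)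
  interpret scaled_groups n m K lam gam \<theta> J D
    by (rule scaled_groups.intro, fact m_pos, fact K_pos, fact lam_decreasing, fact D_infinite,
        fact J_disjoint, fact J_union, fact J_mem, fact J_poly, fact J_infinity,
        fact \<theta>_pos, fact \<theta>_single, fact \<theta>_group, fact lam1_negligible)
  note lam1 = scaling_limits(1)[folded alpha]
  obtain L where "\<exists>i\<in>{1..m}. 0 < L i" and L: "\<forall>i\<in>{1..m}. 0 \<le> L i \<and>
      ((\<lambda>d. real d powr gam i * real (card (J i d)) / real d powr \<alpha>) \<longlongrightarrow> L i) (dims_at_top D)"
    using scaling_limits(2)[folded alpha] by (elim exE conjE)
  then obtain i where i: "i \<in> {1..m}" "0 < L i"
    by (elim bexE)
  note L_lim = L[rule_format, THEN conjunct2]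
  \<comment> \<open>The common limit behind both quantities: \<open>G\<close> tends to
    \<open>W * fisher\<close>, and the squared steps sum to \<open>l\<^sup>2 * W\<close> in the
    limit.\<close>
  define W where "W = (\<Sum>i=1..m. L i / K (n + i))"
  have "0 < W"
    unfolding W_def
  proof (rule sum_pos2[OF _ i(1)])
    show "0 < L i / K (n + i)"
      using i K_pos[of "n + i"] by simp
    show "0 \<le> L i / K (n + i)" if "i \<in> {1..m}" for i
      using L K_pos[of "n + i"] that by simp
  qed simp
  have G_eq: "G = (\<lambda>d. (\<Sum>i=1..m. real d powr gam i * real (card (J i d)) / real d powr \<alpha> / K (n + i)) * fisher)"
    unfolding G fisher_eq sum_distrib_right by (simp add: mult_ac)
  have G_lim: "(G \<longlongrightarrow> W * fisher) (dims_at_top D)"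
    unfolding G_eq W_def
    by (intro tendsto_mult tendsto_sum tendsto_divide tendsto_const L_lim K_group_nonzero)
  \<comment> \<open>\<open>Lim\<close> is a definite description; a limit along a proper filter is
    unique, so exhibiting one fixes its value.\<close>
  have E_eq: "E\<^sub>R = W * fisher"
    unfolding E\<^sub>R by (rule tendsto_Lim[OF DF_neq_bot G_lim])
  have "0 < E\<^sub>R"
    unfolding E_eq using \<open>0 < W\<close> fisher_pos by simp
  have "((\<lambda>d. expected_acceptance f \<theta> \<alpha> d l) \<longlongrightarrow> asymptotic_acceptance E\<^sub>R l) (dims_at_top D)"
    if "0 < l" for l
  proof -
    \<comment> \<open>Passing to the increasing enumeration of \<open>D\<close> makes the sequential
      limit theorem applicable.\<close>
    note in_D = enumerate_in_set[OF D_infinite]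
    have "(\<lambda>k. expected_acceptance f \<theta> \<alpha> (enumerate D k) l)
        \<longlonglongrightarrow> 2 * std_normal_cdf (- (sqrt (l\<^sup>2 * W * fisher) / 2))"
    proof (rule expected_acceptance_tendsto)
      show "0 < \<theta> j (enumerate D k)" if "j \<in> {1..enumerate D k}" for k j
        using \<theta>_pos[OF in_D that] .
      show "0 < enumerate D k" for k
        using dims_gt[OF in_D[of k]] by simp
      show "\<forall>\<^sub>F k in sequentially. \<forall>j\<in>{1..enumerate D k}.
          \<theta> j (enumerate D k) * step_size \<alpha> l (enumerate D k) < e" if "0 < e" for e
        using steps_small[OF L_lim lam1 \<open>0 < l\<close> that]
        unfolding dims_at_top_eq_filtermap[OF D_infinite] eventually_filtermap .
      show "(\<lambda>k. \<Sum>j\<in>{1..enumerate D k}. (\<theta> j (enumerate D k) * step_size \<alpha> l (enumerate D k))\<^sup>2)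
          \<longlonglongrightarrow> l\<^sup>2 * W"
        using steps_sum_tendsto[OF L_lim lam1 \<open>0 < l\<close>]
        unfolding W_def dims_at_top_eq_filtermap[OF D_infinite] filterlim_filtermap .
      show "0 < l\<^sup>2 * W"
        using \<open>0 < l\<close> \<open>0 < W\<close> by simp
    qed fact
    then show ?thesis
      using \<open>0 < l\<close>
      unfolding dims_at_top_eq_filtermap[OF D_infinite] filterlim_filtermap asymptotic_acceptance_def E_eq
      by (simp add: real_sqrt_mult mult.assoc)
  qed
  then show ?thesis
    using G_lim speed_optimum[OF \<open>0 < E\<^sub>R\<close>] unfolding E_eq[symmetric] by blast
qed

end
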